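(* Let $d>1$ be an integer, $p\in(1,\infty)$, $s\in(0,1)$, and $sp\neq 1$. There exists $L_0>0$, depending only on $d,s,p$, such that the following holds. Let $D\subset\mathbb{R}^d$ be a bounded open set which is either a $C^1$ set, or a Lipschitz set with constant $L$ for some $0<L\le L_0$. Then there exists a constant $C\geq 1$ such that for every $u\in \mathcal{X}_0^{s,p}(D)$, $$C\|u\|_{\mathcal{X}^{s,p}(D)}\geq \|u\|_{W^{s,p}(D)}.$$ In particular, $\mathcal{X}_0^{s,p}(D)=W_0^{s,p}(D)$.
   Context: A vector field on an open set $D\subseteq\mathbb{R}^d$ is a measurable map $u\colon D\to\mathbb{R}^d$. $L^p(D)$ denotes the space of vector fields $u$ with $\|u\|_{L^p(D)}=(\int_D|u(x)|^p\,dx)^{1/p}<\infty$. Define the seminorms $$|u|_{W^{s,p}(D)}^p=\int_D\int_D\frac{|u(x)-u(y)|^p}{|x-y|^{d+sp}}\,dx\,dy,\qquad |u|_{\mathcal{X}^{s,p}(D)}^p=\int_D\int_D\frac{\big|(u(x)-u(y))\cdot\frac{x-y}{|x-y|}\big|^p}{|x-y|^{d+sp}}\,dx\,dy,$$ where $\cdot$ is the Euclidean scalar product. $W^{s,p}(D)$ (resp. $\mathcal{X}^{s,p}(D)$) is the space of $u\in L^p(D)$ with $|u|_{W^{s,p}(D)}<\infty$ (resp. $|u|_{\mathcal{X}^{s,p}(D)}<\infty$), with norm $\|u\|_{W^{s,p}(D)}=(\|u\|_{L^p(D)}^p+|u|_{W^{s,p}(D)}^p)^{1/p}$ (resp. $\|u\|_{\mathcal{X}^{s,p}(D)}=(\|u\|_{L^p(D)}^p+|u|_{\mathcal{X}^{s,p}(D)}^p)^{1/p}$).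 $W_0^{s,p}(D)$ and $\mathcal{X}_0^{s,p}(D)$ are the closures of $(C_c^1(D))^d$ (compactly supported $C^1$ vector fields in $D$) in $W^{s,p}(D)$ and $\mathcal{X}^{s,p}(D)$ with respect to the norms $\|\cdot\|_{W^{s,p}(D)}$ and $\|\cdot\|_{\mathcal{X}^{s,p}(D)}$, respectively. Write $x=(x',x_d)$ with $x'\in\mathbb{R}^{d-1}$, $x_d\in\mathbb{R}$. The epigraph of a continuous function $f\colon\mathbb{R}^{d-1}\to\mathbb{R}$ is the open set $\{(x',x_d)\in\mathbb{R}^d: f(x')<x_d\}$. An open set $D\subseteq\mathbb{R}^d$ is Lipschitz with constant $L>0$ if there exist finitely many balls $B_1,\ldots,B_n$ with centers in $\partial D$, epigraphs $U_1,\ldots,U_n$ of functions $f_1,\ldots,f_n\colon\mathbb{R}^{d-1}\to\mathbb{R}$ that are Lipschitz with constant at most $L$, and rigid motions $R_1,\ldots,R_n$ of $\mathbb{R}^d$ such that (i) $\partial D\subset\bigcup_{i=1}^n B_i$; (ii) for each $i$, $R_i(B_i\cap D)\subset U_i$ and $R_i(B_i\cap\partial D)=R_i(B_i)\cap\partial U_i$. $D$ is a $C^1$ set if the same conditions hold with the functions $f_i$ being $C^1$ instead of Lipschitz. *)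

theory Defs
  imports "HOL-Analysis.Analysis"
begin

text \<open>
  A vector field on \<open>D\<close> is a total function whose values outside \<open>D\<close> are ignored: every notion
  below depends on \<open>u\<close> only through its restriction to \<open>D\<close>. Measurability is Lebesgue measurability.
  As the seminorms may be infinite, they and the norms take values in \<open>ennreal\<close>.
\<close>

text \<open>Real powers (of positive exponent) on \<open>[0, \<infinity>]\<close>.\<close>

definition ennreal_powr :: "ennreal \<Rightarrow> real \<Rightarrow> ennreal" where
  "ennreal_powr a r = (if a = top then top else ennreal (enn2real a powr r))"

text \<open>
  The \<open>p\<close>-th powers of the \<open>L\<^sup>p\<close> norm and of the two seminorms. On the diagonal \<open>x = y\<close>, a null set,
  the double integrands are \<open>0\<close> by the convention for division by zero.
\<close>

definition Lp_power :: "real \<Rightarrow> 'a::euclidean_space set \<Rightarrow> ('a \<Rightarrow> 'a) \<Rightarrow> ennreal" where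
  "Lp_power p D u = (\<integral>\<^sup>+x. ennreal (norm (u x) powr p) \<partial>lebesgue_on D)"

definition W_power :: "real \<Rightarrow> real \<Rightarrow> 'a::euclidean_space set \<Rightarrow> ('a \<Rightarrow> 'a) \<Rightarrow> ennreal" where
  "W_power s p D u =
     (\<integral>\<^sup>+x. \<integral>\<^sup>+y. ennreal (norm (u x - u y) powr p / norm (x - y) powr (real DIM('a) + s * p))
        \<partial>lebesgue_on D \<partial>lebesgue_on D)"

definition X_power :: "real \<Rightarrow> real \<Rightarrow> 'a::euclidean_space set \<Rightarrow> ('a \<Rightarrow> 'a) \<Rightarrow> ennreal" where
  "X_power s p D u =
     (\<integral>\<^sup>+x. \<integral>\<^sup>+y. ennreal (\<bar>(u x - u y) \<bullet> ((x - y) /\<^sub>R norm (x - y))\<bar> powr p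
                            / norm (x - y) powr (real DIM('a) + s * p))
        \<partial>lebesgue_on D \<partial>lebesgue_on D)"

definition Lp_space :: "real \<Rightarrow> 'a::euclidean_space set \<Rightarrow> ('a \<Rightarrow> 'a) set" where
  "Lp_space p D = {u \<in> borel_measurable (lebesgue_on D). Lp_power p D u < top}"

definition W_norm :: "real \<Rightarrow> real \<Rightarrow> 'a::euclidean_space set \<Rightarrow> ('a \<Rightarrow> 'a) \<Rightarrow> ennreal" where
  "W_norm s p D u = ennreal_powr (Lp_power p D u + W_power s p D u) (1 / p)"

definition X_norm :: "real \<Rightarrow> real \<Rightarrow> 'a::euclidean_space set \<Rightarrow> ('a \<Rightarrow> 'a) \<Rightarrow> ennreal" where
  "X_norm s p D u = ennreal_powr (Lp_power p D u + X_power s p D u) (1 / p)"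

definition W_space :: "real \<Rightarrow> real \<Rightarrow> 'a::euclidean_space set \<Rightarrow> ('a \<Rightarrow> 'a) set" where
  "W_space s p D = {u \<in> Lp_space p D. W_power s p D u < top}"

definition X_space :: "real \<Rightarrow> real \<Rightarrow> 'a::euclidean_space set \<Rightarrow> ('a \<Rightarrow> 'a) set" where
  "X_space s p D = {u \<in> Lp_space p D. X_power s p D u < top}"

definition C1_on :: "'a::real_normed_vector set \<Rightarrow> ('a \<Rightarrow> 'b::real_normed_vector) \<Rightarrow> bool" where
  "C1_on D f \<longleftrightarrow> (\<exists>f' :: 'a \<Rightarrow> 'a \<Rightarrow>\<^sub>L 'b.
     (\<forall>x\<in>D. (f has_derivative blinfun_apply (f' x)) (at x)) \<and> continuous_on D f')"

definition Cc1 :: "'a::euclidean_space set \<Rightarrow> ('a \<Rightarrow> 'a) set" where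
  "Cc1 D = {\<phi>. C1_on D \<phi> \<and> (\<exists>K. compact K \<and> K \<subseteq> D \<and> (\<forall>x\<in>D - K. \<phi> x = 0))}"

text \<open>Closures of \<open>Cc1 D\<close> in \<open>W_space s p D\<close> and \<open>X_space s p D\<close> for the respective norms.\<close>

definition W0_space :: "real \<Rightarrow> real \<Rightarrow> 'a::euclidean_space set \<Rightarrow> ('a \<Rightarrow> 'a) set" where
  "W0_space s p D =
     {u \<in> W_space s p D. \<forall>\<epsilon>>0. \<exists>\<phi>\<in>Cc1 D. W_norm s p D (\<lambda>x. u x - \<phi> x) < ennreal \<epsilon>}"

definition X0_space :: "real \<Rightarrow> real \<Rightarrow> 'a::euclidean_space set \<Rightarrow> ('a \<Rightarrow> 'a) set" where
  "X0_space s p D =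
     {u \<in> X_space s p D. \<forall>\<epsilon>>0. \<exists>\<phi>\<in>Cc1 D. X_norm s p D (\<lambda>x. u x - \<phi> x) < ennreal \<epsilon>}"

text \<open>
  The decomposition \<open>x = (x', x\<^sub>d)\<close> of Euclidean \<open>d\<close>-space is rendered by the product type
  \<^typ>\<open>(real ^ 'm) \<times> real\<close>, with \<open>d = CARD('m) + 1\<close>; its norm, inner product and Lebesgue measure
  are the Euclidean ones. As \<open>CARD('m) \<ge> 1\<close>, the condition \<open>d > 1\<close> is built in.
  The library constant \<^const>\<open>epigraph\<close> is the closed epigraph, hence the following variant.
\<close>

definition open_epigraph :: "('a \<Rightarrow> real) \<Rightarrow> ('a \<times> real) set" where
  "open_epigraph f = {(x', xd). f x' < xd}"

definition rigid_motion :: "('a::real_inner \<Rightarrow> 'a) \<Rightarrow> bool" where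
  "rigid_motion R \<longleftrightarrow> (\<exists>T a. orthogonal_transformation T \<and> R = (\<lambda>x. a + T x))"

definition locally_epigraph ::
  "((real ^ 'm \<Rightarrow> real) \<Rightarrow> bool) \<Rightarrow> ((real ^ 'm) \<times> real) set \<Rightarrow> bool" where
  "locally_epigraph P D \<longleftrightarrow>
     (\<exists>(n::nat) c r f R.
        (\<forall>i<n. c i \<in> frontier D \<and> 0 < r i \<and> P (f i) \<and> rigid_motion (R i)) \<and>
        frontier D \<subseteq> (\<Union>i<n. ball (c i) (r i)) \<and>
        (\<forall>i<n. R i ` (ball (c i) (r i) \<inter> D) \<subseteq> open_epigraph (f i) \<and>
               R i ` (ball (c i) (r i) \<inter> frontier D)
                 = R i ` ball (c i) (r i) \<inter> frontier (open_epigraph (f i))))"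

definition Lipschitz_set :: "real \<Rightarrow> ((real ^ 'm) \<times> real) set \<Rightarrow> bool" where
  "Lipschitz_set L D \<longleftrightarrow> open D \<and> 0 < L \<and> locally_epigraph (\<lambda>f. L-lipschitz_on UNIV f) D"

definition C1_set :: "((real ^ 'm) \<times> real) set \<Rightarrow> bool" where
  "C1_set D \<longleftrightarrow> open D \<and> locally_epigraph (\<lambda>f. C1_on UNIV f) D"

end

theory Submission
  imports Defs
begin

text \<open>
  Let \<open>x, y \<in> D\<close> be at a small distance \<open>r\<close>, and let \<open>z\<close> range over the part at distance about \<open>l r\<close>
  of a cone with apex \<open>x\<close> inside \<open>D\<close>. The component of \<open>u x - u y\<close> in the direction of \<open>z - x\<close> is the
  sum of the projected differences of \<open>u\<close> for the pairs \<open>(x, z)\<close> and \<open>(y, z)\<close>, up to an error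
  \<open>O(1/l) \<bar>u y - u z\<bar>\<close> that comes from the angle between \<open>z - x\<close> and \<open>z - y\<close>. These directions span, so
  averaging over \<open>z\<close> and integrating over \<open>x\<close> and \<open>y\<close> gives
  \<open>W \<le> C l\<^bsup>sp\<^esup> X + C l\<^bsup>sp - p\<^esup> W + C (L\<^sup>p norm)\<^sup>p\<close>. As \<open>s < 1\<close>, for \<open>l\<close> large the second term is absorbed
  into the left-hand side, which is first made finite by restricting it to \<open>\<bar>x - y\<bar> > \<epsilon>\<close>.
\<close>

section \<open>Interior cones\<close>

text \<open>The points \<open>x + t *\<^sub>R b\<close> with \<open>b\<close> near \<open>e\<close>
  sweep a truncated open cone with apex \<open>x\<close>; direction, aperture and height are common
  to all apexes in \<open>A\<close>. \<open>A\<close> is Borel because it becomes a domain of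
  integration.\<close>

definition cone_condition :: "'a::euclidean_space set \<Rightarrow> 'a set \<Rightarrow> 'a \<Rightarrow> real \<Rightarrow> real \<Rightarrow> bool" where
  "cone_condition D A e \<kappa> \<rho> \<longleftrightarrow>
     A \<in> sets borel \<and> A \<subseteq> D \<and> norm e = 1 \<and>
     (\<forall>x\<in>A. \<forall>b\<in>ball e \<kappa>. \<forall>t. 0 < t \<and> t < \<rho> \<longrightarrow> x + t *\<^sub>R b \<in> D)"

text \<open>Along \<open>b\<close> the height gains \<open>t * snd b\<close>, while \<open>f\<close>
  changes by at most \<open>L * t * norm (fst b)\<close>. The Lipschitz bound is local to
  \<open>S\<close> so that C^1 graphs are covered as well.\<close>

lemma open_epigraph_cone:
  fixes x b :: "'a::real_normed_vector \<times> real"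
  assumes "L-lipschitz_on S f" "x \<in> open_epigraph f" "fst x \<in> S" "fst (x + t *\<^sub>R b) \<in> S" "0 \<le> t"
    and "L * norm (fst b) \<le> snd b"
  shows "x + t *\<^sub>R b \<in> open_epigraph f"
proof -
  have "\<bar>f (fst (x + t *\<^sub>R b)) - f (fst x)\<bar> \<le> L * norm (t *\<^sub>R fst b)"
    using lipschitz_onD[OF assms(1) assms(4) assms(3)] by (simp add: dist_norm)
  also have "\<dots> \<le> t * snd b"
    using mult_left_mono[OF assms(6,5)] assms(5) by (simp add: algebra_simps)
  finally show ?thesis
    using assms(2) by (auto simp: open_epigraph_def case_prod_beta)
qed

lemma open_open_epigraph:
  assumes "continuous_on UNIV f"
  shows "open (open_epigraph f)"
proof -
  have "open_epigraph f = {x. f (fst x) < snd x}"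
    by (auto simp: open_epigraph_def)
  moreover have "continuous_on UNIV (\<lambda>x. f (fst x))"
    by (rule continuous_on_compose2[OF assms continuous_on_fst[OF continuous_on_id]]) simp
  ultimately show ?thesis
    by (auto intro!: open_Collect_less continuous_intros)
qed

text \<open>The derivative is bounded on a compact ball, and the ball is convex. A bound on balls is
  enough because a chart sees only a bounded part of the graph.\<close>

lemma C1_on_UNIV_lipschitz:
  fixes f :: "'a::euclidean_space \<Rightarrow> 'b::real_normed_vector"
  assumes "C1_on UNIV f"
  shows "continuous_on UNIV f" "\<exists>L. L-lipschitz_on (cball 0 M) f"
proof -
  obtain f' :: "'a \<Rightarrow> 'a \<Rightarrow>\<^sub>L 'b" where
    f': "\<And>x. (f has_derivative blinfun_apply (f' x)) (at x)" and cont: "continuous_on UNIV f'"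
    using assms by (auto simp: C1_on_def)
  show "continuous_on UNIV f"
    using has_derivative_continuous[OF f'] by (simp add: continuous_at_imp_continuous_on)
  have "compact (f' ` cball 0 M)"
    by (intro compact_continuous_image continuous_on_subset[OF cont]) auto
  then obtain L where L: "0 < L" "\<forall>x\<in>f' ` cball 0 M. norm x \<le> L"
    using compact_imp_bounded bounded_pos by metis
  have "L-lipschitz_on (cball 0 M) f"
  proof (rule bounded_derivative_imp_lipschitz)
    show "(f has_derivative blinfun_apply (f' x)) (at x within cball 0 M)" for x
      using f' by (rule has_derivative_at_withinI)
    show "onorm (blinfun_apply (f' x)) \<le> L" if "x \<in> cball 0 M" for x
      using L(2) that by (auto simp: norm_blinfun.rep_eq)
  qed (use L in auto)
  then show "\<exists>L. L-lipschitz_on (cball 0 M) f" ..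
qed

text \<open>A segment that starts in \<open>D\<close> and stays in the epigraph of a chart cannot meet the frontier of \<open>D\<close>,
  so it stays in \<open>D\<close>.\<close>

lemma chart_cone_condition:
  fixes f :: "real ^ 'm \<Rightarrow> real" and D :: "((real ^ 'm) \<times> real) set"
  assumes "rigid_motion R" and cont: "continuous_on UNIV f"
    and lip: "\<And>M. \<exists>L. L-lipschitz_on (cball 0 M) f"
    and "open D" "0 < \<delta>"
    and sub: "R ` (ball c r \<inter> D) \<subseteq> open_epigraph f"
    and fr: "R ` (ball c r \<inter> frontier D) = R ` ball c r \<inter> frontier (open_epigraph f)"
  shows "\<exists>e. \<exists>\<kappa>>0. cone_condition D (D \<inter> cball c (r - \<delta>)) e (min \<kappa> (1/2)) (\<delta> / 2)"
proof -
  obtain T a where T: "orthogonal_transformation T" and R: "R = (\<lambda>x. a + T x)"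
    using assms(1) by (auto simp: rigid_motion_def)
  have linT: "linear T"
    using T by (rule orthogonal_transformation_linear)
  \<comment> \<open>The axis of the cone is the direction that the chart turns into the
    vertical.\<close>
  obtain e where e: "T e = (0, 1)"
    using orthogonal_transformation_surj[OF T] by (metis surjD)
  have norm_T: "norm (T x) = norm x" for x
    using T by (simp add: orthogonal_transformation_norm)
  have ne: "norm e = 1"
    using norm_T[of e] by (simp add: e norm_Pair)
  \<comment> \<open>The chart maps its ball over \<open>cball 0 M\<close>, the region where the
    Lipschitz bound on \<open>f\<close> is used.\<close>
  define M where "M = norm a + norm c + \<bar>r\<bar>"
  obtain L where L: "L-lipschitz_on (cball 0 M) f"
    using lip by blast
  have L0: "0 \<le> L"
    using L lipschitz_on_nonneg by blast
  \<comment> \<open>Chosen so that \<open>L * \<kappa> = 1 - \<kappa>\<close>: a vector within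
    \<kappa> of the vertical has horizontal part below \<kappa> and vertical part above
    \<open>1 - \<kappa>\<close>, as \<open>open_epigraph_cone\<close> demands.\<close>
  define \<kappa> where "\<kappa> = 1 / (L + 1)"
  have \<kappa>: "0 < \<kappa>" "L * \<kappa> = 1 - \<kappa>"
    using L0 by (auto simp: \<kappa>_def field_simps)
  have M: "fst (R x) \<in> cball 0 M" if "x \<in> ball c r" for x
  proof -
    have "norm (fst (R x)) \<le> norm (R x)"
      by (metis norm_fst_le prod.collapse)
    also have "\<dots> \<le> norm a + norm x"
      unfolding R using norm_triangle_ineq[of a "T x"] by (simp add: norm_T)
    also have "norm x \<le> norm c + \<bar>r\<bar>"
      using that norm_triangle_sub[of x c] by (simp add: dist_norm norm_minus_commute)
    finally show ?thesis
      by (simp add: M_def)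
  qed
  have openU: "open (open_epigraph f)"
    using cont by (rule open_open_epigraph)
  have cone: "x + t *\<^sub>R b \<in> D"
    if x: "x \<in> D" "x \<in> cball c (r - \<delta>)" and b: "b \<in> ball e (min \<kappa> (1/2))" and t: "0 < t" "t < \<delta> / 2"
    for x b t
  proof (rule ccontr)
    assume no: "x + t *\<^sub>R b \<notin> D"
    have "norm b \<le> norm e + norm (b - e)"
      by (rule norm_triangle_sub)
    then have nb: "norm b \<le> 2"
      using b ne by (simp add: dist_norm norm_minus_commute)
    let ?S = "closed_segment x (x + t *\<^sub>R b)"
    have seg: "y \<in> ball c r \<and> R y \<in> open_epigraph f" if "y \<in> ?S" for y
    proof -
      obtain \<theta> where \<theta>: "0 \<le> \<theta>" "\<theta> \<le> 1" "y = x + (\<theta> * t) *\<^sub>R b"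
        using \<open>y \<in> ?S\<close> by (auto simp: in_segment algebra_simps)
      \<comment> \<open>With \<open>norm b \<le> 2\<close> and \<open>t < \<delta> / 2\<close> the
        whole segment stays within \<delta> of \<open>x\<close>, hence inside the chart
        ball.\<close>
      have "\<theta> * t * norm b \<le> t * 2"
        using \<theta> t nb by (intro mult_mono) (auto simp: mult_left_le_one_le)
      then have "\<theta> * t * norm b < \<delta>"
        using t by linarith
      then have "dist x y < \<delta>"
        using t \<theta> by (simp add: dist_norm abs_mult)
      then have y: "y \<in> ball c r"
        using x(2) dist_triangle[of c y x] by auto
      have xB: "x \<in> ball c r"
        using x(2) assms(5) by auto
      have Rx: "R x \<in> open_epigraph f"
        using sub x xB by auto
      have Ry: "R y = R x + (\<theta> * t) *\<^sub>R T b"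
        using linT by (simp add: R \<theta> linear_add linear_scale)
      have "norm (T b - (0, 1)) = norm (b - e)"
        using linT by (metis e linear_diff norm_T)
      then have Tb: "norm (T b - (0, 1)) < \<kappa>"
        using b by (simp add: dist_norm norm_minus_commute)
      have "norm (fst (T b)) \<le> norm (T b - (0, 1))"
        using norm_fst_le[of "fst (T b)" "snd (T b) - 1"] by (metis diff_0_right diff_Pair prod.collapse)
      then have "L * norm (fst (T b)) \<le> L * \<kappa>"
        using Tb L0 by (intro mult_left_mono) auto
      moreover have "\<bar>snd (T b) - 1\<bar> \<le> norm (T b - (0, 1))"
        using norm_snd_le[of "snd (T b) - 1" "fst (T b)"]
        by (metis diff_0_right diff_Pair prod.collapse real_norm_def)
      ultimately have "L * norm (fst (T b)) \<le> snd (T b)"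
        using Tb \<kappa> by linarith
      then have "R x + (\<theta> * t) *\<^sub>R T b \<in> open_epigraph f"
        using \<theta> t M[OF y, unfolded Ry]
        by (intro open_epigraph_cone[OF L Rx M[OF xB]]) auto
      with y show ?thesis
        by (simp add: Ry)
    qed
    have "?S \<inter> frontier D \<noteq> {}"
      using x no by (intro connected_Int_frontier) auto
    then obtain y where y: "y \<in> ?S" "y \<in> frontier D"
      by auto
    then have "R y \<in> frontier (open_epigraph f)"
      using seg fr by blast
    then show False
      using seg[OF y(1)] openU by (simp add: frontier_def interior_open)
  qed
  have "cone_condition D (D \<inter> cball c (r - \<delta>)) e (min \<kappa> (1/2)) (\<delta> / 2)"
    using \<open>open D\<close> ne cone unfolding cone_condition_def by auto
  then show ?thesis
    using \<kappa>(1) by blast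
qed

text \<open>Compactness of the frontier places every point of \<open>D\<close> near it in a slightly
  shrunk chart ball, where the chart provides cones; the points with a \<delta>-ball inside
  \<open>D\<close> form one more piece. As there are finitely many pieces, aperture and height can
  be made common.\<close>

lemma locally_epigraph_cone_cover:
  fixes D :: "((real ^ 'm) \<times> real) set"
  assumes "locally_epigraph P D" "open D" "bounded D"
    and cont: "\<And>f. P f \<Longrightarrow> continuous_on UNIV f"
    and lip: "\<And>f M. P f \<Longrightarrow> \<exists>L. L-lipschitz_on (cball 0 M) f"
  shows "\<exists>(n::nat) A e \<kappa> \<rho>. 0 < \<kappa> \<and> \<kappa> \<le> 1/2 \<and> 0 < \<rho> \<and>
           (\<forall>i<n. cone_condition D (A i) (e i) \<kappa> \<rho>) \<and> D \<subseteq> (\<Union>i<n. A i)"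
proof -
  obtain n :: nat and c r f R where
    H: "(\<forall>i<n. c i \<in> frontier D \<and> 0 < r i \<and> P (f i) \<and> rigid_motion (R i)) \<and>
        frontier D \<subseteq> (\<Union>i<n. ball (c i) (r i)) \<and>
        (\<forall>i<n. R i ` (ball (c i) (r i) \<inter> D) \<subseteq> open_epigraph (f i) \<and>
               R i ` (ball (c i) (r i) \<inter> frontier D)
                 = R i ` ball (c i) (r i) \<inter> frontier (open_epigraph (f i)))"
    using assms(1) unfolding locally_epigraph_def by (elim exE)
  note chart = conjunct1[OF H, rule_format] and cover = conjunct1[OF conjunct2[OF H]]
    and sub_fr = conjunct2[OF conjunct2[OF H], rule_format]
  have "compact (frontier D)"
    using \<open>bounded D\<close> by (rule compact_frontier_bounded)
  \<comment> \<open>\<eta> is a Lebesgue number for the cover of the frontier by the chart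
    balls.\<close>
  then obtain \<eta> where \<eta>: "0 < \<eta>"
    "\<forall>x\<in>frontier D. \<exists>G\<in>(\<lambda>i. ball (c i) (r i)) ` {..<n}. ball x \<eta> \<subseteq> G"
  proof (rule Heine_Borel_lemma)
    show "frontier D \<subseteq> \<Union> ((\<lambda>i. ball (c i) (r i)) ` {..<n})"
      by (rule cover)
  qed auto
  \<comment> \<open>Half the Lebesgue number: if \<open>ball x \<delta>\<close> meets the frontier
    at \<open>z\<close>, it lies in \<open>ball z \<eta>\<close> and so in one chart ball, which
    puts \<open>x\<close> within \<open>r i - \<delta>\<close> of its centre.\<close>
  define \<delta> where "\<delta> = \<eta> / 2"
  have \<delta>: "0 < \<delta>"
    using \<eta> by (simp add: \<delta>_def)
  have "\<forall>i<n. \<exists>e. \<exists>\<kappa>>0. cone_condition D (D \<inter> cball (c i) (r i - \<delta>)) e (min \<kappa> (1/2)) (\<delta> / 2)"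
  proof (intro allI impI)
    fix i assume i: "i < n"
    have Pi: "P (f i)" and Ri: "rigid_motion (R i)"
      using chart[OF i] by auto
    show "\<exists>e. \<exists>\<kappa>>0. cone_condition D (D \<inter> cball (c i) (r i - \<delta>)) e (min \<kappa> (1/2)) (\<delta> / 2)"
      using sub_fr[OF i]
      by (intro chart_cone_condition[OF Ri cont[OF Pi] lip[OF Pi] \<open>open D\<close> \<delta>]) auto
  qed
  then obtain e k where ek: "\<And>i. i < n \<Longrightarrow> 0 < k i"
    "\<And>i. i < n \<Longrightarrow> cone_condition D (D \<inter> cball (c i) (r i - \<delta>)) (e i) (min (k i) (1/2)) (\<delta> / 2)"
    by metis
  \<comment> \<open>Inserting \<open>1/2\<close> gives the upper bound on \<kappa> and keeps the set
    nonempty when there is no chart.\<close>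
  define \<kappa> where "\<kappa> = Min (insert (1/2) (k ` {..<n}))"
  have "0 < \<kappa>"
    using ek(1) by (auto simp: \<kappa>_def)
  moreover have "\<kappa> \<le> 1/2" "\<And>i. i < n \<Longrightarrow> \<kappa> \<le> k i"
    unfolding \<kappa>_def by (intro Min_le; simp)+
  ultimately have \<kappa>: "0 < \<kappa>" "\<kappa> \<le> 1/2" "\<And>i. i < n \<Longrightarrow> \<kappa> \<le> k i"
    by auto
  \<comment> \<open>Index \<open>n\<close> is the extra piece away from the frontier. Short segments
    in every direction stay in \<open>D\<close> there, so \<open>e0\<close> can be any unit
    vector.\<close>
  define A where "A i = (if i < n then D \<inter> cball (c i) (r i - \<delta>) else {x. ball x \<delta> \<subseteq> D})" for i
  define e0 where "e0 = (0 :: real ^ 'm, 1 :: real)"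
  have e0: "norm e0 = 1"
    by (simp add: e0_def norm_Pair)
  define e' where "e' i = (if i < n then e i else e0)" for i
  have "cone_condition D (A i) (e' i) \<kappa> (\<delta> / 2)" if "i < Suc n" for i
  proof (cases "i < n")
    case True
    then have "ball (e i) \<kappa> \<subseteq> ball (e i) (min (k i) (1/2))"
      using \<kappa> by (intro subset_ball) auto
    then show ?thesis
      using ek(2)[OF True] True unfolding cone_condition_def A_def e'_def by auto
  next
    case False
    \<comment> \<open>As the complement of a union of open balls, this piece is closed and therefore
      Borel.\<close>
    have "{x. ball x \<delta> \<subseteq> D} = - (\<Union>y\<in>-D. ball y \<delta>)"
      by (auto simp: subset_eq dist_commute)
    moreover have "closed (- (\<Union>y\<in>-D. ball y \<delta>))"
      by (intro closed_Compl open_UN) auto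
    ultimately have "closed {x. ball x \<delta> \<subseteq> D}"
      by (simp only:)
    moreover have "x + t *\<^sub>R b \<in> D"
      if x: "ball x \<delta> \<subseteq> D" and b: "b \<in> ball e0 \<kappa>" and t: "0 < t" "t < \<delta> / 2" for x b t
    proof -
      have "norm b \<le> norm e0 + norm (b - e0)"
        by (rule norm_triangle_sub)
      then have "norm b \<le> 2"
        using b e0 \<kappa> by (simp add: dist_norm norm_minus_commute)
      then have "t * norm b \<le> t * 2"
        using t by (intro mult_left_mono) auto
      then have "t * norm b < \<delta>"
        using t by linarith
      then have "x + t *\<^sub>R b \<in> ball x \<delta>"
        using t by (simp add: dist_norm)
      then show ?thesis
        using x by auto
    qed
    moreover have "{x. ball x \<delta> \<subseteq> D} \<subseteq> D"
      using \<delta> by auto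
    ultimately show ?thesis
      using False e0 by (auto simp: cone_condition_def A_def e'_def)
  qed
  moreover have "D \<subseteq> (\<Union>i<Suc n. A i)"
  proof
    fix x assume x: "x \<in> D"
    show "x \<in> (\<Union>i<Suc n. A i)"
    proof (cases "ball x \<delta> \<subseteq> D")
      case True
      then have "x \<in> A n"
        by (simp add: A_def)
      then show ?thesis
        by auto
    next
      case False
      then have "ball x \<delta> \<inter> frontier D \<noteq> {}"
        using x centre_in_ball[of x \<delta>] \<delta> by (intro connected_Int_frontier connected_ball) blast+
      then obtain z where z: "z \<in> ball x \<delta>" "z \<in> frontier D"
        by auto
      obtain i where i: "i < n" "ball z \<eta> \<subseteq> ball (c i) (r i)"
        using \<eta> z by auto
      have "ball x \<delta> \<subseteq> ball z \<eta>"
        using z(1) by (simp add: ball_subset_ball_iff \<delta>_def)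
      then have "ball x \<delta> \<subseteq> ball (c i) (r i)"
        using i by auto
      then have "x \<in> A i"
        using \<delta> i x by (simp add: ball_subset_ball_iff A_def dist_commute)
      then show ?thesis
        using i by auto
    qed
  qed
  ultimately show ?thesis
    using \<kappa> \<delta> by (intro exI[of _ "Suc n"] exI[of _ A] exI[of _ e'] exI[of _ \<kappa>] exI[of _ "\<delta> / 2"]) auto
qed

section \<open>Absorbing the Gagliardo energy\<close>

definition pair_energy :: "real \<Rightarrow> ('a::euclidean_space \<Rightarrow> 'a \<Rightarrow> ennreal) \<Rightarrow> ennreal" where
  "pair_energy q H = (\<integral>\<^sup>+x. \<integral>\<^sup>+y. H x y * ennreal (norm (x - y) powr (- q)) \<partial>lborel \<partial>lborel)"

text \<open>The density \<open>(l r)\<^bsup>-d\<^esup>\<close> of an average over points at distance \<open>\<rho>\<close> of order \<open>l r\<close>, times the singular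
  weight \<open>r\<^bsup>-q\<^esup>\<close>, where \<open>q = d + s p\<close>.\<close>

definition kernel :: "real \<Rightarrow> real \<Rightarrow> real \<Rightarrow> real \<Rightarrow> real \<Rightarrow> real" where
  "kernel d q l r \<rho> =
     (if l * r / 4 < \<rho> \<and> \<rho> < 2 * l * r then (l * r) powr (- d) * r powr (- q) else 0)"

lemma kernel_nonneg [simp]: "0 \<le> kernel d q l r \<rho>"
  by (simp add: kernel_def)

lemma measurable_kernel [measurable]:
  assumes [measurable]: "f \<in> borel_measurable M" "g \<in> borel_measurable M"
  shows "(\<lambda>x. kernel d q l (f x) (g x)) \<in> borel_measurable M"
  unfolding kernel_def by measurable

text \<open>For \<open>q = d + s p\<close> this is of order \<open>l powr (s * p)\<close>, the
  growth in \<open>l\<close> that the factor \<open>(4 / l) powr p\<close> has to beat.\<close>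

definition kernel_const :: "'a::euclidean_space itself \<Rightarrow> real \<Rightarrow> real \<Rightarrow> real" where
  "kernel_const _ q l =
     unit_ball_vol DIM('a) * 8 powr real DIM('a) * 2 powr q * l powr (q - real DIM('a))"

text \<open>For fixed \<rho> the kernel is supported where
  \<open>\<rho> / (2 * l) < norm (a - b) < 4 * \<rho> / l\<close>. There it is at most
  \<open>?c\<close>, and the volume of the ball of radius \<open>4 * \<rho> / l\<close> cancels the
  power \<open>- d\<close> of \<rho> in \<open>?c\<close>, so that only the singular weight in
  \<rho> remains.\<close>

lemma nn_integral_kernel_le:
  fixes a :: "'a::euclidean_space"
  assumes "0 < l" "0 \<le> q"
  shows "(\<integral>\<^sup>+b. ennreal (kernel DIM('a) q l (norm (a - b)) \<rho>) \<partial>lborel)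
           \<le> ennreal (kernel_const TYPE('a) q l * \<rho> powr (- q))"
proof (cases "0 < \<rho>")
  case False
  have "kernel DIM('a) q l (norm (a - b)) \<rho> = 0" for b
  proof -
    have "0 \<le> l * norm (a - b) / 4"
      using \<open>0 < l\<close> by simp
    with False have "\<not> (l * norm (a - b) / 4 < \<rho>)"
      by linarith
    then show ?thesis
      by (simp add: kernel_def)
  qed
  then show ?thesis
    by simp
next
  case True
  let ?c = "(\<rho> / 2) powr (- real DIM('a)) * (\<rho> / (2 * l)) powr (- q)"
  have le: "kernel DIM('a) q l (norm (a - b)) \<rho> \<le> ?c * indicator (ball a (4 * \<rho> / l)) b" for b
  proof (cases "l * norm (a - b) / 4 < \<rho> \<and> \<rho> < 2 * l * norm (a - b)")
    case True
    let ?r = "norm (a - b)"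
    have "\<rho> / (2 * l) \<le> ?r" "\<rho> / 2 \<le> l * ?r" "?r < 4 * \<rho> / l"
      using True \<open>0 < l\<close> by (auto simp: field_simps)
    moreover from this have "(l * ?r) powr (- real DIM('a)) * ?r powr (- q) \<le> ?c"
      using \<open>0 < \<rho>\<close> assms by (intro mult_mono powr_mono2') auto
    ultimately show ?thesis
      using True by (simp add: kernel_def dist_norm)
  qed (auto simp: kernel_def)
  have "(\<integral>\<^sup>+b. ennreal (kernel DIM('a) q l (norm (a - b)) \<rho>) \<partial>lborel)
          \<le> (\<integral>\<^sup>+b. ennreal ?c * indicator (ball a (4 * \<rho> / l)) b \<partial>lborel)"
    using ennreal_leI[OF le] by (intro nn_integral_mono) (simp add: ennreal_mult' ennreal_indicator)
  also have "\<dots> = ennreal ?c * emeasure lborel (ball a (4 * \<rho> / l))"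
    by (rule nn_integral_cmult_indicator) simp
  also have "\<dots> = ennreal (?c * (unit_ball_vol DIM('a) * (4 * \<rho> / l) ^ DIM('a)))"
    using True assms by (simp add: emeasure_ball ennreal_mult')
  also have "?c * (unit_ball_vol DIM('a) * (4 * \<rho> / l) ^ DIM('a)) =
      kernel_const TYPE('a) q l * \<rho> powr (- q)"
  proof -
    have "(4 * \<rho> / l) ^ DIM('a) = (4 * \<rho> / l) powr DIM('a)"
      using True assms by (simp add: powr_realpow)
    also have "\<dots> = (8 * (\<rho> / 2)) powr DIM('a) * l powr (- real DIM('a))"
      using True assms by (simp add: powr_divide powr_minus_divide)
    also have "(8 * (\<rho> / 2)) powr DIM('a) = 8 powr DIM('a) * (\<rho> / 2) powr DIM('a)"
      using True by (subst powr_mult) auto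
    finally have 1: "(4 * \<rho> / l) ^ DIM('a) =
        8 powr DIM('a) * (\<rho> / 2) powr DIM('a) * l powr (- real DIM('a))" .
    have 2: "(\<rho> / 2) powr (- real DIM('a)) * (\<rho> / 2) powr DIM('a) = 1"
      using True by (simp flip: powr_add)
    have 3: "(\<rho> / (2 * l)) powr (- q) = 2 powr q * l powr q * \<rho> powr (- q)"
      using True assms by (simp add: powr_divide powr_minus_divide powr_mult)
    have 4: "l powr (q - DIM('a)) = l powr q * l powr (- real DIM('a))"
      by (simp flip: powr_add)
    show ?thesis
      unfolding 1 3 4 kernel_const_def using 2 by (simp add: algebra_simps)
  qed
  finally show ?thesis .
qed

text \<open>By Tonelli, \<open>y\<close> is integrated out first. This turns the kernel back into
  the singular weight in \<open>norm (x - z)\<close>.\<close>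

lemma triple_integral_kernel_le:
  fixes H :: "'a::euclidean_space \<Rightarrow> 'a \<Rightarrow> ennreal"
  assumes [measurable]: "case_prod H \<in> borel_measurable (lborel \<Otimes>\<^sub>M lborel)"
    and "0 < l" "0 \<le> q"
  shows "(\<integral>\<^sup>+x. \<integral>\<^sup>+y. \<integral>\<^sup>+z. ennreal (kernel DIM('a) q l (norm (x - y)) (norm (x - z))) * H x z
            \<partial>lborel \<partial>lborel \<partial>lborel) \<le> ennreal (kernel_const TYPE('a) q l) * pair_energy q H"
proof -
  let ?K = "\<lambda>x y z. ennreal (kernel DIM('a) q l (norm (x - y)) (norm (x - z)))"
  have inner: "(\<integral>\<^sup>+y. \<integral>\<^sup>+z. ?K x y z * H x z \<partial>lborel \<partial>lborel)
      \<le> ennreal (kernel_const TYPE('a) q l) *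
          (\<integral>\<^sup>+z. H x z * ennreal (norm (x - z) powr (- q)) \<partial>lborel)" for x
  proof -
    have "(\<integral>\<^sup>+y. \<integral>\<^sup>+z. ?K x y z * H x z \<partial>lborel \<partial>lborel)
        = (\<integral>\<^sup>+z. \<integral>\<^sup>+y. ?K x y z * H x z \<partial>lborel \<partial>lborel)"
      by (rule lborel_pair.Fubini'[symmetric]) measurable
    also have "\<dots> = (\<integral>\<^sup>+z. (\<integral>\<^sup>+y. ?K x y z \<partial>lborel) * H x z \<partial>lborel)"
      by (intro nn_integral_cong nn_integral_multc) measurable
    also have "\<dots> \<le> (\<integral>\<^sup>+z. ennreal (kernel_const TYPE('a) q l * norm (x - z) powr (- q)) * H x z \<partial>lborel)"
      using assms by (intro nn_integral_mono mult_right_mono nn_integral_kernel_le) auto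
    also have "\<dots> = (\<integral>\<^sup>+z. ennreal (kernel_const TYPE('a) q l) * (H x z * ennreal (norm (x - z) powr (- q))) \<partial>lborel)"
      by (intro nn_integral_cong) (simp add: ennreal_mult'' mult_ac)
    also have "\<dots> = ennreal (kernel_const TYPE('a) q l) *
          (\<integral>\<^sup>+z. H x z * ennreal (norm (x - z) powr (- q)) \<partial>lborel)"
      by (intro nn_integral_cmult) measurable
    finally show ?thesis .
  qed
  have "(\<integral>\<^sup>+x. \<integral>\<^sup>+y. \<integral>\<^sup>+z. ?K x y z * H x z \<partial>lborel \<partial>lborel \<partial>lborel)
     \<le> (\<integral>\<^sup>+x. ennreal (kernel_const TYPE('a) q l) *
          (\<integral>\<^sup>+z. H x z * ennreal (norm (x - z) powr (- q)) \<partial>lborel) \<partial>lborel)"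
    by (intro nn_integral_mono inner)
  also have "\<dots> = ennreal (kernel_const TYPE('a) q l) * pair_energy q H"
    unfolding pair_energy_def by (intro nn_integral_cmult) measurable
  finally show ?thesis .
qed

section \<open>Projections averaged over a cone\<close>

text \<open>Even if \<open>w\<close> is orthogonal to \<open>e\<close>, tilting \<open>e\<close> by
  \<open>\<kappa> / 2\<close> towards \<open>w\<close> or \<open>- w\<close> yields a direction
  \<open>b0\<close> with a definite component along \<open>w\<close>. This persists on a smaller
  ball around \<open>x + R *\<^sub>R b0\<close>, over which the integrand is bounded below.\<close>

lemma cone_average:
  fixes w e x :: "'a::euclidean_space"
  assumes "norm e = 1" "0 < \<kappa>" "\<kappa> \<le> 1/2" "0 < R" "0 < p"
  shows "ennreal (unit_ball_vol DIM('a) * (\<kappa> / 4) ^ DIM('a) * (\<kappa> / 6) powr p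
              * R powr DIM('a) * norm w powr p)
       \<le> (\<integral>\<^sup>+z. ennreal (\<bar>w \<bullet> ((z - x) /\<^sub>R norm (z - x))\<bar> powr p)
                 * indicator (ball (x + R *\<^sub>R e) (R * \<kappa>)) z \<partial>lborel)"
proof (cases "w = 0")
  case False
  \<comment> \<open>The sign makes the contributions of \<open>e\<close> and of the tilt to
    \<open>w \<bullet> b0\<close> add up instead of cancelling.\<close>
  define \<sigma> :: real where "\<sigma> = (if 0 \<le> w \<bullet> e then 1 else -1)"
  define b0 where "b0 = e + (\<sigma> * \<kappa> / 2 / norm w) *\<^sub>R w"
  have \<sigma>: "\<bar>\<sigma>\<bar> = 1" "0 \<le> \<sigma> * (w \<bullet> e)"
    by (auto simp: \<sigma>_def)
  have d0: "norm (b0 - e) = \<kappa> / 2"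
    using False \<sigma> assms by (simp add: b0_def abs_mult)
  have "\<sigma> * (w \<bullet> b0) = \<sigma> * (w \<bullet> e) + \<sigma> * \<sigma> * \<kappa> / 2 * (norm w)\<^sup>2 / norm w"
    by (simp add: b0_def algebra_simps power2_norm_eq_inner)
  also have "\<sigma> * \<sigma> = 1"
    by (simp add: \<sigma>_def)
  finally have "\<sigma> * (w \<bullet> b0) \<ge> \<kappa> / 2 * norm w"
    using \<sigma> False by (simp add: power2_eq_square)
  moreover have "\<bar>\<sigma> * (w \<bullet> b0)\<bar> = \<bar>w \<bullet> b0\<bar>"
    using \<sigma> by (simp add: abs_mult)
  ultimately have w0: "\<bar>w \<bullet> b0\<bar> \<ge> \<kappa> / 2 * norm w"
    by linarith
  let ?B = "ball (x + R *\<^sub>R b0) (R * \<kappa> / 4)"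
  have sub: "?B \<subseteq> ball (x + R *\<^sub>R e) (R * \<kappa>)"
  proof -
    have "dist (x + R *\<^sub>R b0) (x + R *\<^sub>R e) = norm (R *\<^sub>R (b0 - e))"
      by (simp add: dist_norm algebra_simps)
    also have "\<dots> = R * \<kappa> / 2"
      using d0 assms by simp
    finally have "dist (x + R *\<^sub>R b0) (x + R *\<^sub>R e) + R * \<kappa> / 4 \<le> R * \<kappa>"
      using mult_pos_pos[OF assms(4,2)] by linarith
    then show ?thesis
      by (simp only: ball_subset_ball_iff simp_thms)
  qed
  have lower: "(\<kappa> / 6 * norm w) powr p \<le> \<bar>w \<bullet> ((z - x) /\<^sub>R norm (z - x))\<bar> powr p" if "z \<in> ?B" for z
  proof (rule powr_mono2)
    define b where "b = (z - x) /\<^sub>R R"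
    have z: "z - x = R *\<^sub>R b"
      using assms by (simp add: b_def)
    have "x + R *\<^sub>R b0 - z = R *\<^sub>R (b0 - b)"
      using z by (simp add: algebra_simps)
    then have "R * norm (b0 - b) < R * (\<kappa> / 4)"
      using that assms by (simp add: dist_norm)
    then have bb: "norm (b - b0) < \<kappa> / 4"
      using assms by (simp add: norm_minus_commute)
    have "norm (b - e) \<le> norm (b - b0) + norm (b0 - e)"
      using norm_triangle_ineq[of "b - b0" "b0 - e"] by simp
    then have be: "norm (b - e) < 1/2"
      using bb d0 assms by linarith
    have nb: "norm b \<le> 3/2" "0 < norm b"
      using be norm_triangle_sub[of b e] norm_triangle_sub[of e b] assms
      by (auto simp: norm_minus_commute simp del: zero_less_norm_iff)
    have "\<bar>w \<bullet> (b - b0)\<bar> \<le> norm w * (\<kappa> / 4)"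
      using bb by (intro order_trans[OF Cauchy_Schwarz_ineq2] mult_left_mono) auto
    then have "\<bar>w \<bullet> b - w \<bullet> b0\<bar> \<le> \<kappa> / 4 * norm w"
      by (simp add: inner_diff_right mult.commute)
    \<comment> \<open>Of the \<open>\<kappa> / 2\<close> at \<open>b0\<close>, moving to
      \<open>b\<close> loses at most \<open>\<kappa> / 4\<close>; dividing by
      \<open>norm b \<le> 3/2\<close> to normalise then leaves \<open>\<kappa> / 6\<close>.\<close>
    then have "\<bar>w \<bullet> b\<bar> \<ge> \<kappa> / 4 * norm w"
      using w0 by linarith
    moreover have "\<kappa> / 6 * norm w * norm b \<le> \<kappa> / 6 * norm w * (3/2)"
      using nb assms by (intro mult_left_mono) auto
    ultimately have "\<kappa> / 6 * norm w * norm b \<le> \<bar>w \<bullet> b\<bar>"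
      by linarith
    then have "\<kappa> / 6 * norm w \<le> \<bar>w \<bullet> b\<bar> / norm b"
      using nb by (simp add: pos_le_divide_eq)
    also have "\<dots> = \<bar>w \<bullet> ((z - x) /\<^sub>R norm (z - x))\<bar>"
      using assms nb unfolding z by (simp add: abs_mult divide_simps)
    finally show "\<kappa> / 6 * norm w \<le> \<bar>w \<bullet> ((z - x) /\<^sub>R norm (z - x))\<bar>" .
  qed (use assms in auto)
  have "unit_ball_vol DIM('a) * (\<kappa> / 4) ^ DIM('a) * (\<kappa> / 6) powr p * R powr DIM('a) * norm w powr p
      = (\<kappa> / 6 * norm w) powr p * (unit_ball_vol DIM('a) * (R * \<kappa> / 4) ^ DIM('a))"
    using assms powr_mult[of "\<kappa> / 6" "norm w" p]
    by (simp add: powr_realpow power_mult_distrib power_divide)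
  moreover have "emeasure lborel ?B = ennreal (unit_ball_vol DIM('a) * (R * \<kappa> / 4) ^ DIM('a))"
    using assms by (subst emeasure_ball) auto
  ultimately have "ennreal (unit_ball_vol DIM('a) * (\<kappa> / 4) ^ DIM('a) * (\<kappa> / 6) powr p
              * R powr DIM('a) * norm w powr p) = ennreal ((\<kappa> / 6 * norm w) powr p) * emeasure lborel ?B"
    by (simp only: ennreal_mult'[OF powr_ge_zero])
  also have "\<dots> = (\<integral>\<^sup>+z. ennreal ((\<kappa> / 6 * norm w) powr p) * indicator ?B z \<partial>lborel)"
    by (rule nn_integral_cmult_indicator[symmetric]) simp
  also have "\<dots> \<le> (\<integral>\<^sup>+z. ennreal (\<bar>w \<bullet> ((z - x) /\<^sub>R norm (z - x))\<bar> powr p)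
                 * indicator (ball (x + R *\<^sub>R e) (R * \<kappa>)) z \<partial>lborel)"
  proof (intro nn_integral_mono)
    fix z
    show "ennreal ((\<kappa> / 6 * norm w) powr p) * indicator ?B z
        \<le> ennreal (\<bar>w \<bullet> ((z - x) /\<^sub>R norm (z - x))\<bar> powr p) * indicator (ball (x + R *\<^sub>R e) (R * \<kappa>)) z"
      using lower[of z] sub by (cases "z \<in> ?B") (auto intro!: ennreal_leI simp: indicator_def)
  qed
  finally show ?thesis .
qed (use assms in simp)

lemma powr_add3_le:
  fixes a b c p :: real
  assumes "0 \<le> a" "0 \<le> b" "0 \<le> c" "0 \<le> p"
  shows "(a + b + c) powr p \<le> 3 powr p * (a powr p + b powr p + c powr p)"
proof -
  let ?m = "max a (max b c)"
  have "(a + b + c) powr p \<le> (3 * ?m) powr p"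
    using assms by (intro powr_mono2) auto
  also have "\<dots> = 3 powr p * ?m powr p"
    using assms by (simp add: powr_mult)
  also have "?m powr p \<le> a powr p + b powr p + c powr p"
    by (auto simp: max_def)
  finally show ?thesis
    by simp
qed

definition proj_diff :: "('a::real_inner \<Rightarrow> 'a) \<Rightarrow> 'a \<Rightarrow> 'a \<Rightarrow> real" where
  "proj_diff u x y = \<bar>(u x - u y) \<bullet> ((x - y) /\<^sub>R norm (x - y))\<bar>"

lemma proj_diff_nonneg [simp]: "0 \<le> proj_diff u x y"
  by (simp add: proj_diff_def)

lemma abs_inner_direction_commute:
  "\<bar>c \<bullet> ((z - x) /\<^sub>R norm (z - x))\<bar> = \<bar>c \<bullet> ((x - z) /\<^sub>R norm (x - z))\<bar>"
proof -
  have "(z - x) /\<^sub>R norm (z - x) = - ((x - z) /\<^sub>R norm (x - z))"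
    by (metis minus_diff_eq norm_minus_commute scaleR_minus_right)
  then show ?thesis
    by (metis abs_minus_cancel inner_minus_right)
qed

lemma proj_diff_commute: "proj_diff u x y = proj_diff u y x"
  unfolding proj_diff_def
  by (subst abs_inner_direction_commute) (metis abs_minus_cancel inner_minus_left minus_diff_eq)

text \<open>Two errors add up, each at most \<open>norm (x - y) / norm (z - x)\<close>: one from
  replacing the vector \<open>z - x\<close> by \<open>z - y\<close>, one from replacing its length,
  by the reverse triangle inequality.\<close>

lemma norm_direction_diff_le:
  fixes x y z :: "'a::real_inner"
  assumes "z \<noteq> x" "z \<noteq> y"
  shows "norm ((z - x) /\<^sub>R norm (z - x) - (z - y) /\<^sub>R norm (z - y)) \<le> 2 * norm (x - y) / norm (z - x)"
proof -
  let ?n = "norm (z - x)" and ?m = "norm (z - y)"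
  have "(z - x) /\<^sub>R ?n - (z - y) /\<^sub>R ?m = (y - x) /\<^sub>R ?n + (1 / ?n - 1 / ?m) *\<^sub>R (z - y)"
    by (simp add: algebra_simps inverse_eq_divide)
  also have "norm \<dots> \<le> norm ((y - x) /\<^sub>R ?n) + norm ((1 / ?n - 1 / ?m) *\<^sub>R (z - y))"
    by (rule norm_triangle_ineq)
  also have "norm ((y - x) /\<^sub>R ?n) = norm (x - y) / ?n"
    by (simp add: norm_minus_commute divide_inverse mult.commute)
  also have "norm ((1 / ?n - 1 / ?m) *\<^sub>R (z - y)) = \<bar>(1 / ?n - 1 / ?m) * ?m\<bar>"
    by (simp add: abs_mult)
  also have "(1 / ?n - 1 / ?m) * ?m = ?m / ?n - 1"
    using assms by (simp add: left_diff_distrib)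
  also have "?m / ?n - 1 = (?m - ?n) / ?n"
    using assms by (simp add: diff_divide_distrib)
  also have "\<bar>(?m - ?n) / ?n\<bar> = \<bar>?m - ?n\<bar> / ?n"
    by (simp add: abs_divide)
  also have "\<dots> \<le> norm (x - y) / ?n"
    using norm_triangle_ineq3[of "z - y" "z - x"] by (intro divide_right_mono) auto
  finally show ?thesis
    by simp
qed

text \<open>The rotation of the direction as \<open>x\<close> moves to \<open>y\<close> costs a factor \<open>4 / l\<close>, which is what
  makes the last term absorbable.\<close>

lemma proj_diff_triangle:
  fixes u :: "'a::real_inner \<Rightarrow> 'a"
  assumes "4 \<le> l" "0 < norm (x - y)" "l * norm (x - y) / 2 < norm (x - z)" "0 \<le> p"
  shows "\<bar>(u x - u y) \<bullet> ((z - x) /\<^sub>R norm (z - x))\<bar> powr p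
     \<le> 3 powr p * (proj_diff u x z powr p + proj_diff u y z powr p + (4 / l) powr p * norm (u y - u z) powr p)"
proof -
  let ?\<theta> = "(z - x) /\<^sub>R norm (z - x)" and ?\<eta> = "(z - y) /\<^sub>R norm (z - y)"
  \<comment> \<open>Since \<open>l \<ge> 4\<close>, \<open>z\<close> is farther from
    \<open>x\<close> than \<open>y\<close> is, so it differs from both and the two directions are
    unit vectors.\<close>
  have "4 * norm (x - y) \<le> l * norm (x - y)"
    using assms by (intro mult_right_mono) auto
  then have n: "norm (x - y) < norm (z - x)" "0 < norm (z - x)"
    using assms(2,3) norm_minus_commute[of x z] by linarith+
  then have ne: "z \<noteq> x" "z \<noteq> y"
    by (auto simp: norm_minus_commute)
  have "norm (?\<theta> - ?\<eta>) \<le> 2 * norm (x - y) / norm (z - x)"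
    using ne by (rule norm_direction_diff_le)
  also have "\<dots> \<le> 4 / l"
    using assms n by (simp add: divide_simps norm_minus_commute)
  finally have rot: "norm (?\<theta> - ?\<eta>) \<le> 4 / l" .
  \<comment> \<open>Each difference is projected along its own segment, as in the X-seminorm; the
    mismatch of directions multiplies a full difference.\<close>
  have "(a - b) \<bullet> \<theta> = (a - c) \<bullet> \<theta> + (c - b) \<bullet> \<eta> + (c - b) \<bullet> (\<theta> - \<eta>)" for a b c \<theta> \<eta> :: 'a
    by (simp add: inner_diff_left inner_diff_right)
  from this[of "u x" "u y" ?\<theta> "u z" ?\<eta>] have "\<bar>(u x - u y) \<bullet> ?\<theta>\<bar> \<le> \<bar>(u x - u z) \<bullet> ?\<theta>\<bar> + \<bar>(u z - u y) \<bullet> ?\<eta>\<bar> + \<bar>(u z - u y) \<bullet> (?\<theta> - ?\<eta>)\<bar>"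
    by linarith
  also have "\<bar>(u x - u z) \<bullet> ?\<theta>\<bar> = proj_diff u x z"
    unfolding proj_diff_def by (rule abs_inner_direction_commute)
  also have "\<bar>(u z - u y) \<bullet> ?\<eta>\<bar> = proj_diff u y z"
    unfolding proj_diff_commute[of u y z] by (simp add: proj_diff_def)
  also have "\<bar>(u z - u y) \<bullet> (?\<theta> - ?\<eta>)\<bar> \<le> norm (u y - u z) * (4 / l)"
    unfolding norm_minus_commute[of "u y" "u z"]
    by (rule order_trans[OF Cauchy_Schwarz_ineq2 mult_left_mono[OF rot norm_ge_zero]])
  finally have "\<bar>(u x - u y) \<bullet> ?\<theta>\<bar> powr p
      \<le> (proj_diff u x z + proj_diff u y z + 4 / l * norm (u y - u z)) powr p"
    using assms by (intro powr_mono2) (auto simp: mult.commute)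
  also have "\<dots> \<le> 3 powr p * (proj_diff u x z powr p + proj_diff u y z powr p
       + (4 / l * norm (u y - u z)) powr p)"
    using assms by (intro powr_add3_le) auto
  also have "(4 / l * norm (u y - u z)) powr p = (4 / l) powr p * norm (u y - u z) powr p"
    by (rule powr_mult)
  finally show ?thesis .
qed


section \<open>Truncated energies and the estimate on one piece\<close>

definition X_dens :: "real \<Rightarrow> 'a::euclidean_space set \<Rightarrow> ('a \<Rightarrow> 'a) \<Rightarrow> 'a \<Rightarrow> 'a \<Rightarrow> ennreal" where
  "X_dens p D u x y = indicator D x * indicator D y * ennreal (proj_diff u x y powr p)"

text \<open>\<open>S\<close> truncates the distance: above \<epsilon> for finiteness, below \<delta>
  for near pairs, from \<delta> on for far pairs. Only the first point is confined to
  \<open>A\<close>, being the apex of the cone.\<close>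

definition W_dens ::
  "real \<Rightarrow> real set \<Rightarrow> 'a::euclidean_space set \<Rightarrow> 'a set \<Rightarrow> ('a \<Rightarrow> 'a) \<Rightarrow> 'a \<Rightarrow> 'a \<Rightarrow> ennreal" where
  "W_dens p S A D u x y =
     indicator A x * indicator D y * indicator S (norm (x - y)) * ennreal (norm (u x - u y) powr p)"

lemma measurable_X_dens [measurable]:
  assumes [measurable]: "u \<in> borel_measurable borel" "D \<in> sets borel"
  shows "case_prod (X_dens p D u) \<in> borel_measurable (lborel \<Otimes>\<^sub>M lborel)"
  unfolding X_dens_def proj_diff_def case_prod_beta by measurable

lemma measurable_W_dens [measurable]:
  assumes [measurable]: "u \<in> borel_measurable borel" "D \<in> sets borel" "A \<in> sets borel" "S \<in> sets borel"
  shows "case_prod (W_dens p S A D u) \<in> borel_measurable (lborel \<Otimes>\<^sub>M lborel)"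
  unfolding W_dens_def case_prod_beta by measurable

lemma pair_energy_add:
  fixes H G :: "'a::euclidean_space \<Rightarrow> 'a \<Rightarrow> ennreal"
  assumes [measurable]: "case_prod H \<in> borel_measurable (lborel \<Otimes>\<^sub>M lborel)"
    "case_prod G \<in> borel_measurable (lborel \<Otimes>\<^sub>M lborel)"
  shows "pair_energy q (\<lambda>x y. H x y + G x y) = pair_energy q H + pair_energy q G"
  unfolding pair_energy_def distrib_right by (simp add: nn_integral_add)

lemma pair_energy_cmult:
  fixes H :: "'a::euclidean_space \<Rightarrow> 'a \<Rightarrow> ennreal"
  assumes [measurable]: "case_prod H \<in> borel_measurable (lborel \<Otimes>\<^sub>M lborel)"
  shows "pair_energy q (\<lambda>x y. c * H x y) = c * pair_energy q H"
  unfolding pair_energy_def mult.assoc by (simp add: nn_integral_cmult)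

lemma pair_energy_mono:
  assumes "\<And>x y. H x y \<le> G x y"
  shows "pair_energy q H \<le> pair_energy q G"
  unfolding pair_energy_def by (intro nn_integral_mono mult_right_mono assms) auto

text \<open>The constant of \<open>cone_average\<close>. It is independent of \<open>l\<close>, so
  \<open>l\<close> can be chosen after it.\<close>

definition cone_const :: "'a::euclidean_space itself \<Rightarrow> real \<Rightarrow> real \<Rightarrow> real" where
  "cone_const _ p \<kappa> = unit_ball_vol DIM('a) * (\<kappa> / 4) ^ DIM('a) * (\<kappa> / 6) powr p"

text \<open>\<open>cone_average\<close> at scale \<open>R = l * norm (x - y)\<close> bounds the full
  difference by projections, which \<open>proj_diff_triangle\<close> then splits. The W-term on the
  right keeps the truncation at \<epsilon>, so after integration the same truncated energy reappears
  and can be absorbed.\<close>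

lemma cone_pointwise:
  fixes D A :: "'a::euclidean_space set"
  assumes cone: "cone_condition D A e \<kappa> \<rho>" and "0 < \<kappa>" "\<kappa> \<le> 1/2" "4 \<le> l" "0 < p"
    and "x \<in> A" "y \<in> D" and r: "0 \<le> \<epsilon>" "\<epsilon> < norm (x - y)" "l * norm (x - y) < \<rho>"
    and [measurable]: "u \<in> borel_measurable borel" "D \<in> sets borel"
  shows "ennreal (cone_const TYPE('a) p \<kappa>) * (ennreal (norm (u x - u y) powr p) * ennreal (norm (x - y) powr (- q)))
    \<le> (\<integral>\<^sup>+z. ennreal (3 powr p) *
         (ennreal (kernel DIM('a) q l (norm (x - y)) (norm (x - z))) * X_dens p D u x z +
          ennreal (kernel DIM('a) q l (norm (x - y)) (norm (y - z))) *
            (X_dens p D u y z + ennreal ((4 / l) powr p) * W_dens p {\<epsilon><..} D D u y z)) \<partial>lborel)"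
proof -
  let ?r = "norm (x - y)" and ?w = "u x - u y"
  define R where "R = l * ?r"
  \<comment> \<open>The common value of both kernels on the averaging ball.\<close>
  define k where "k = R powr (- real DIM('a)) * ?r powr (- q)"
  have r0: "0 < ?r"
    using r by linarith
  have R: "4 * ?r \<le> R" "0 < R"
    using r0 \<open>4 \<le> l\<close> by (auto simp: R_def intro!: mult_right_mono mult_pos_pos)
  have k0: "0 \<le> k"
    by (simp add: k_def)
  have e: "norm e = 1"
    using cone by (simp add: cone_condition_def)
  have AD: "A \<subseteq> D"
    using cone by (simp add: cone_condition_def)
  let ?B = "ball (x + R *\<^sub>R e) (R * \<kappa>)"
  have [measurable]: "?B \<in> sets borel"
    by simp
  let ?c = "cone_const TYPE('a) p \<kappa>"
  have RR: "R powr (- real DIM('a)) * R powr real DIM('a) = 1"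
    using R by (simp flip: powr_add)
  have "ennreal ?c * (ennreal (norm ?w powr p) * ennreal (?r powr (- q)))
      = ennreal (?c * (norm ?w powr p * ?r powr (- q)))"
    by (simp add: ennreal_mult'')
  \<comment> \<open>The inserted factor is \<open>1\<close>: its negative power goes into
    \<open>k\<close>, its positive power is the one in \<open>cone_average\<close>.\<close>
  also have "?c * (norm ?w powr p * ?r powr (- q)) =
      (R powr (- real DIM('a)) * R powr real DIM('a)) * (?c * (norm ?w powr p * ?r powr (- q)))"
    by (simp only: RR)
  also have "\<dots> = k * (?c * R powr real DIM('a) * norm ?w powr p)"
    by (simp only: k_def mult_ac)
  also have "ennreal \<dots> = ennreal k * ennreal (?c * R powr real DIM('a) * norm ?w powr p)"
    using k0 by (rule ennreal_mult')
  also have "\<dots> \<le> ennreal k * (\<integral>\<^sup>+z. ennreal (\<bar>?w \<bullet> ((z - x) /\<^sub>R norm (z - x))\<bar> powr p) * indicator ?B z \<partial>lborel)"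
    unfolding cone_const_def
    using assms R e by (intro mult_left_mono cone_average) auto
  also have "\<dots> = (\<integral>\<^sup>+z. ennreal k * (ennreal (\<bar>?w \<bullet> ((z - x) /\<^sub>R norm (z - x))\<bar> powr p) * indicator ?B z) \<partial>lborel)"
    by (rule nn_integral_cmult[symmetric]) measurable
  also have "\<dots> \<le> (\<integral>\<^sup>+z. ennreal (3 powr p) *
         (ennreal (kernel DIM('a) q l (norm (x - y)) (norm (x - z))) * X_dens p D u x z +
          ennreal (kernel DIM('a) q l (norm (x - y)) (norm (y - z))) *
            (X_dens p D u y z + ennreal ((4 / l) powr p) * W_dens p {\<epsilon><..} D D u y z)) \<partial>lborel)"
  proof (intro nn_integral_mono)
    fix z
    show "ennreal k * (ennreal (\<bar>?w \<bullet> ((z - x) /\<^sub>R norm (z - x))\<bar> powr p) * indicator ?B z)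
      \<le> ennreal (3 powr p) *
         (ennreal (kernel DIM('a) q l (norm (x - y)) (norm (x - z))) * X_dens p D u x z +
          ennreal (kernel DIM('a) q l (norm (x - y)) (norm (y - z))) *
            (X_dens p D u y z + ennreal ((4 / l) powr p) * W_dens p {\<epsilon><..} D D u y z))"
    proof (cases "z \<in> ?B")
      case True
      define b where "b = (z - x) /\<^sub>R R"
      have z: "z = x + R *\<^sub>R b"
        using R by (simp add: b_def)
      have "dist (x + R *\<^sub>R e) z = R * norm (e - b)"
        using R by (simp add: z dist_norm flip: scaleR_diff_right)
      then have eb: "norm (e - b) < \<kappa>"
        using True R by simp
      then have "z \<in> D"
        using cone \<open>x \<in> A\<close> R r unfolding z by (auto simp: cone_condition_def dist_norm R_def)
      have "norm e - norm b \<le> norm (e - b)" "norm b - norm e \<le> norm (e - b)"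
        using norm_triangle_ineq2[of e b] norm_triangle_ineq2[of b e]
        by (simp_all add: norm_minus_commute)
      \<comment> \<open>This is where \<open>\<kappa> \<le> 1/2\<close> enters: the distance from
        \<open>x\<close> to \<open>z\<close> lies between \<open>R / 2\<close> and
        \<open>3/2 * R\<close>.\<close>
      then have nb: "1/2 < norm b" "norm b < 3/2"
        using eb e \<open>\<kappa> \<le> 1/2\<close> by linarith+
      have "norm (x - z) = R * norm b"
        using R by (simp add: z)
      moreover have "R * (1/2) < R * norm b" "R * norm b < R * (3/2)"
        using nb R by (auto intro!: mult_strict_left_mono simp del: mult_less_cancel_left)
      ultimately have xz: "R / 2 < norm (x - z)" "norm (x - z) < 3/2 * R"
        by linarith+
      have "norm (x - z) \<le> norm (x - y) + norm (y - z)" "norm (y - z) \<le> norm (x - z) + norm (x - y)"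
        using norm_triangle_ineq[of "x - y" "y - z"] norm_triangle_ineq[of "x - z" "y - x"]
        by (simp_all add: norm_minus_commute)
      \<comment> \<open>Since \<open>norm (x - y) \<le> R / 4\<close>, passing from \<open>x\<close>
        to \<open>y\<close> keeps the distance in the range of the kernel, and above \<epsilon>
        because \<open>R / 4\<close> is at least \<open>norm (x - y)\<close>.\<close>
      then have yz: "R / 4 < norm (y - z)" "norm (y - z) < 2 * R" "\<epsilon> < norm (y - z)"
        using xz R r by linarith+
      have K: "kernel DIM('a) q l ?r (norm (x - z)) = k" "kernel DIM('a) q l ?r (norm (y - z)) = k"
        using xz yz R by (auto simp: kernel_def k_def R_def mult.assoc)
      let ?a = "proj_diff u x z powr p" and ?b = "proj_diff u y z powr p"
        and ?d = "(4 / l) powr p * norm (u y - u z) powr p"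
      have "\<bar>?w \<bullet> ((z - x) /\<^sub>R norm (z - x))\<bar> powr p \<le> 3 powr p * (?a + ?b + ?d)"
        using assms r0 xz by (intro proj_diff_triangle) (auto simp: R_def)
      then have "k * \<bar>?w \<bullet> ((z - x) /\<^sub>R norm (z - x))\<bar> powr p \<le> 3 powr p * (k * ?a + k * (?b + ?d))"
        using mult_left_mono[OF _ k0] by (fastforce simp: algebra_simps)
      then have "ennreal (k * \<bar>?w \<bullet> ((z - x) /\<^sub>R norm (z - x))\<bar> powr p)
          \<le> ennreal (3 powr p * (k * ?a + k * (?b + ?d)))"
        by (rule ennreal_leI)
      also have "\<dots> = ennreal (3 powr p) * (ennreal k * ennreal ?a + ennreal k *
          (ennreal ?b + ennreal ((4 / l) powr p) * ennreal (norm (u y - u z) powr p)))"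
        using k0 by (simp add: ennreal_mult ennreal_plus)
      finally show ?thesis
        using True \<open>z \<in> D\<close> \<open>x \<in> A\<close> \<open>y \<in> D\<close> AD yz k0 unfolding K
        by (simp add: X_dens_def W_dens_def ennreal_mult subset_iff)
    qed simp
  qed
  finally show ?thesis .
qed

text \<open>\<open>cone_pointwise\<close> is integrated over \<open>x\<close> and \<open>y\<close>;
  the bound \<open>\<rho> / l\<close> on their distance ensures that the averaging ball fits into
  the cone.\<close>

lemma cone_energy:
  fixes D A :: "'a::euclidean_space set"
  assumes cone: "cone_condition D A e \<kappa> \<rho>" and "0 < \<kappa>" "\<kappa> \<le> 1/2" "4 \<le> l" "0 < p" "0 \<le> q" "0 \<le> \<epsilon>"
    and [measurable]: "u \<in> borel_measurable borel" "D \<in> sets borel"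
  shows "ennreal (cone_const TYPE('a) p \<kappa>) * pair_energy q (W_dens p {\<epsilon><..<\<rho> / l} A D u)
    \<le> ennreal (3 powr p * kernel_const TYPE('a) q l) *
        (2 * pair_energy q (X_dens p D u)
          + ennreal ((4 / l) powr p) * pair_energy q (W_dens p {\<epsilon><..} D D u))"
proof -
  have [measurable]: "A \<in> sets borel"
    using cone by (simp add: cone_condition_def)
  let ?c = "ennreal (cone_const TYPE('a) p \<kappa>)"
  let ?X = "X_dens p D u"
  define Y where "Y y z = X_dens p D u y z + ennreal ((4 / l) powr p) * W_dens p {\<epsilon><..} D D u y z" for y z
  have [measurable]: "case_prod Y \<in> borel_measurable (lborel \<Otimes>\<^sub>M lborel)"
    unfolding Y_def case_prod_beta by measurable
  let ?K = "\<lambda>x y t. ennreal (kernel DIM('a) q l (norm (x - y)) t)"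
  let ?C = "ennreal (kernel_const TYPE('a) q l)"
  have "?c * pair_energy q (W_dens p {\<epsilon><..<\<rho> / l} A D u)
     = (\<integral>\<^sup>+x. \<integral>\<^sup>+y. ?c * W_dens p {\<epsilon><..<\<rho> / l} A D u x y * ennreal (norm (x - y) powr (- q)) \<partial>lborel \<partial>lborel)"
    by (subst pair_energy_cmult[symmetric]) (simp_all add: pair_energy_def)
  also have "\<dots> \<le> (\<integral>\<^sup>+x. \<integral>\<^sup>+y. \<integral>\<^sup>+z. ennreal (3 powr p) *
     (?K x y (norm (x - z)) * ?X x z + ?K x y (norm (y - z)) * Y y z) \<partial>lborel \<partial>lborel \<partial>lborel)"
  proof (intro nn_integral_mono)
    fix x y
    show "?c * W_dens p {\<epsilon><..<\<rho> / l} A D u x y * ennreal (norm (x - y) powr (- q))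
      \<le> (\<integral>\<^sup>+z. ennreal (3 powr p) *
           (?K x y (norm (x - z)) * ?X x z + ?K x y (norm (y - z)) * Y y z) \<partial>lborel)"
    proof (cases "x \<in> A \<and> y \<in> D \<and> norm (x - y) \<in> {\<epsilon><..<\<rho> / l}")
      case True
      then show ?thesis
        using cone_pointwise[OF cone, of l p x y \<epsilon> u q] assms
        by (simp add: W_dens_def Y_def field_simps)
    qed (auto simp: W_dens_def)
  qed
  also have "\<dots> = ennreal (3 powr p) *
     ((\<integral>\<^sup>+x. \<integral>\<^sup>+y. \<integral>\<^sup>+z. ?K x y (norm (x - z)) * ?X x z \<partial>lborel \<partial>lborel \<partial>lborel) +
      (\<integral>\<^sup>+x. \<integral>\<^sup>+y. \<integral>\<^sup>+z. ?K x y (norm (y - z)) * Y y z \<partial>lborel \<partial>lborel \<partial>lborel))"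
    by (simp add: nn_integral_cmult nn_integral_add)
  \<comment> \<open>The second kernel is centred at \<open>y\<close>, so \<open>y\<close> becomes
    the outer variable, to match \<open>triple_integral_kernel_le\<close>.\<close>
  also have "(\<integral>\<^sup>+x. \<integral>\<^sup>+y. \<integral>\<^sup>+z. ?K x y (norm (y - z)) * Y y z \<partial>lborel \<partial>lborel \<partial>lborel)
     = (\<integral>\<^sup>+y. \<integral>\<^sup>+x. \<integral>\<^sup>+z. ?K x y (norm (y - z)) * Y y z \<partial>lborel \<partial>lborel \<partial>lborel)"
    by (rule lborel_pair.Fubini'[symmetric]) measurable
  also have "\<dots> = (\<integral>\<^sup>+y. \<integral>\<^sup>+x. \<integral>\<^sup>+z. ?K y x (norm (y - z)) * Y y z \<partial>lborel \<partial>lborel \<partial>lborel)"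
    by (simp only: norm_minus_commute)
  also have "ennreal (3 powr p) *
     ((\<integral>\<^sup>+x. \<integral>\<^sup>+y. \<integral>\<^sup>+z. ?K x y (norm (x - z)) * ?X x z \<partial>lborel \<partial>lborel \<partial>lborel) + \<dots>)
     \<le> ennreal (3 powr p) * (?C * pair_energy q ?X + ?C * pair_energy q Y)"
    using assms by (intro mult_left_mono add_mono triple_integral_kernel_le) auto
  also have "pair_energy q Y = pair_energy q ?X +
      ennreal ((4 / l) powr p) * pair_energy q (W_dens p {\<epsilon><..} D D u)"
    unfolding Y_def by (simp add: pair_energy_add pair_energy_cmult)
  also have "ennreal (3 powr p) * (?C * pair_energy q ?X + ?C * (pair_energy q ?X +
      ennreal ((4 / l) powr p) * pair_energy q (W_dens p {\<epsilon><..} D D u)))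
     = ennreal (3 powr p * kernel_const TYPE('a) q l) *
        (2 * pair_energy q (X_dens p D u)
          + ennreal ((4 / l) powr p) * pair_energy q (W_dens p {\<epsilon><..} D D u))"
    by (simp add: ennreal_mult' distrib_left mult.assoc mult_2 add.assoc)
  finally show ?thesis .
qed

section \<open>Far pairs, removal of the truncation, absorption\<close>

definition Lp_mass :: "real \<Rightarrow> 'a::euclidean_space set \<Rightarrow> ('a \<Rightarrow> 'a) \<Rightarrow> ennreal" where
  "Lp_mass p D u = (\<integral>\<^sup>+x. indicator D x * ennreal (norm (u x) powr p) \<partial>lborel)"

text \<open>Off the diagonal the weight is at most \<open>\<delta> powr (- q)\<close>, and each of
  \<open>u x\<close>, \<open>u y\<close> is integrated against the measure of \<open>D\<close> in
  the other variable. The bound serves both for far pairs and for the finiteness of truncated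
  energies.\<close>

lemma far_energy_le:
  fixes D :: "'a::euclidean_space set"
  assumes "0 < \<delta>" "0 < p" "0 \<le> q"
    and [measurable]: "u \<in> borel_measurable borel" "D \<in> sets borel"
  shows "pair_energy q (W_dens p {\<delta>..} D D u)
    \<le> ennreal (2 * 3 powr p * \<delta> powr (- q)) * emeasure lborel D * Lp_mass p D u"
proof -
  let ?f = "\<lambda>x. indicator D x * ennreal (norm (u x) powr p)"
  let ?c = "ennreal (3 powr p * \<delta> powr (- q))"
  have "pair_energy q (W_dens p {\<delta>..} D D u) \<le>
      (\<integral>\<^sup>+x. \<integral>\<^sup>+y. ?c * (?f x * indicator D y + indicator D x * ?f y) \<partial>lborel \<partial>lborel)"
    unfolding pair_energy_def
  proof (intro nn_integral_mono)
    fix x y :: 'a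
    show "W_dens p {\<delta>..} D D u x y * ennreal (norm (x - y) powr (- q))
      \<le> ?c * (?f x * indicator D y + indicator D x * ?f y)"
    proof (cases "x \<in> D \<and> y \<in> D \<and> \<delta> \<le> norm (x - y)")
      case True
      have "norm (u x - u y) powr p \<le> (norm (u x) + norm (u y) + 0) powr p"
        using \<open>0 < p\<close> by (intro powr_mono2) (auto intro: norm_triangle_ineq4)
      also have "\<dots> \<le> 3 powr p * (norm (u x) powr p + norm (u y) powr p + 0 powr p)"
        using \<open>0 < p\<close> by (intro powr_add3_le) auto
      finally have "norm (u x - u y) powr p \<le> 3 powr p * (norm (u x) powr p + norm (u y) powr p)"
        by simp
      moreover have "norm (x - y) powr (- q) \<le> \<delta> powr (- q)"
        using True assms by (intro powr_mono2') auto
      ultimately have "norm (u x - u y) powr p * norm (x - y) powr (- q)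
         \<le> 3 powr p * (norm (u x) powr p + norm (u y) powr p) * \<delta> powr (- q)"
        by (intro mult_mono) auto
      also have "\<dots> = (3 powr p * \<delta> powr (- q)) * (norm (u x) powr p + norm (u y) powr p)"
        by simp
      finally have "ennreal (norm (u x - u y) powr p * norm (x - y) powr (- q))
         \<le> ennreal ((3 powr p * \<delta> powr (- q)) * (norm (u x) powr p + norm (u y) powr p))"
        by (rule ennreal_leI)
      also have "\<dots> = ?c * (ennreal (norm (u x) powr p) + ennreal (norm (u y) powr p))"
        by (subst ennreal_mult'') (auto simp: ennreal_plus)
      finally show ?thesis
        using True by (simp add: W_dens_def ennreal_mult'')
    qed (auto simp: W_dens_def)
  qed
  also have "\<dots> = ?c * (Lp_mass p D u * emeasure lborel D + emeasure lborel D * Lp_mass p D u)"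
    by (simp add: nn_integral_cmult nn_integral_add nn_integral_multc Lp_mass_def)
  also have "\<dots> = ennreal (2 * 3 powr p * \<delta> powr (- q)) * emeasure lborel D * Lp_mass p D u"
  proof -
    have "ennreal (2 * 3 powr p * \<delta> powr (- q)) = ennreal (2 * (3 powr p * \<delta> powr (- q)))"
      by (simp only: mult.assoc)
    also have "\<dots> = ennreal 2 * ?c"
      by (rule ennreal_mult') simp
    finally have "ennreal (2 * 3 powr p * \<delta> powr (- q)) = 2 * ?c"
      by simp
    moreover have "a * b + b * a = 2 * (b * a)" for a b :: ennreal
      by (simp only: mult.commute[of b a] mult_2)
    ultimately show ?thesis
      by (simp only: mult_ac)
  qed
  finally show ?thesis .
qed

lemma pair_energy_sum:
  fixes H :: "nat \<Rightarrow> 'a::euclidean_space \<Rightarrow> 'a \<Rightarrow> ennreal"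
  assumes "\<And>i. i < n \<Longrightarrow> case_prod (H i) \<in> borel_measurable (lborel \<Otimes>\<^sub>M lborel)"
  shows "pair_energy q (\<lambda>x y. \<Sum>i<n. H i x y) = (\<Sum>i<n. pair_energy q (H i))"
  using assms
proof (induction n)
  case (Suc n)
  have [measurable]: "case_prod (H i) \<in> borel_measurable (lborel \<Otimes>\<^sub>M lborel)" if "i \<in> {..<n}" for i
    using Suc.prems that by auto
  have "case_prod (\<lambda>x y. \<Sum>i<n. H i x y) \<in> borel_measurable (lborel \<Otimes>\<^sub>M lborel)"
    unfolding case_prod_beta by measurable
  then show ?case
    using Suc by (simp add: pair_energy_add)
qed (simp add: pair_energy_def)

text \<open>Monotone convergence along the truncations \<open>1 / real (Suc m)\<close>; on the
  diagonal the density vanishes.\<close>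

lemma W_dens_UNIV_le:
  fixes D :: "'a::euclidean_space set"
  assumes "\<And>\<epsilon>. 0 < \<epsilon> \<Longrightarrow> pair_energy q (W_dens p {\<epsilon><..} D D u) \<le> K"
    and [measurable]: "u \<in> borel_measurable borel" "D \<in> sets borel"
  shows "pair_energy q (W_dens p UNIV D D u) \<le> K"
proof -
  define g where "g m x y = W_dens p {1 / real (Suc m)<..} D D u x y * ennreal (norm (x - y) powr (- q))"
    for m :: nat and x y :: 'a
  have [measurable]: "case_prod (g m) \<in> borel_measurable (lborel \<Otimes>\<^sub>M lborel)" for m
    unfolding g_def case_prod_beta by measurable
  have mono: "g m x y \<le> g k x y" if "m \<le> k" for m k x y
  proof -
    have "1 / real (Suc k) \<le> 1 / real (Suc m)"
      using that by (simp add: frac_le)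
    then show ?thesis
      unfolding g_def W_dens_def by (intro mult_right_mono mult_left_mono) (auto simp: indicator_def)
  qed
  have "W_dens p UNIV D D u x y * ennreal (norm (x - y) powr (- q)) \<le> (SUP m. g m x y)" for x y
  proof (cases "x = y")
    case False
    then obtain m where "1 / real (Suc m) < norm (x - y)"
      by (metis eq_iff_diff_eq_0 nat_approx_posE zero_less_norm_iff)
    then show ?thesis
      by (intro SUP_upper2[of m]) (auto simp: g_def W_dens_def)
  qed (simp add: W_dens_def)
  then have "pair_energy q (W_dens p UNIV D D u) \<le> (\<integral>\<^sup>+x. \<integral>\<^sup>+y. (SUP m. g m x y) \<partial>lborel \<partial>lborel)"
    unfolding pair_energy_def by (intro nn_integral_mono) auto
  also have "\<dots> = (\<integral>\<^sup>+x. (SUP m. \<integral>\<^sup>+y. g m x y \<partial>lborel) \<partial>lborel)"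
    using mono by (intro nn_integral_cong nn_integral_monotone_convergence_SUP)
      (auto simp: incseq_def le_fun_def)
  also have "\<dots> = (SUP m. \<integral>\<^sup>+x. \<integral>\<^sup>+y. g m x y \<partial>lborel \<partial>lborel)"
    using mono by (intro nn_integral_monotone_convergence_SUP)
      (auto simp: incseq_def le_fun_def intro!: nn_integral_mono)
  also have "\<dots> \<le> K"
    using assms(1) by (intro SUP_least) (auto simp: g_def pair_energy_def)
  finally show ?thesis .
qed

text \<open>Finiteness of \<open>w\<close> is essential: \<open>w = top\<close> satisfies the
  inequality for every \<open>a\<close>.\<close>

lemma ennreal_absorb_half:
  fixes w a :: ennreal
  assumes "w < top" "w \<le> a + ennreal (1/2) * w"
  shows "w \<le> 2 * a"
proof (cases a)
  case (real r)
  obtain t where t: "w = ennreal t" "0 \<le> t"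
    using assms(1) by (cases w) auto
  have "ennreal (r + 1/2 * t) = ennreal r + ennreal (1/2 * t)"
    using real t by (intro ennreal_plus) auto
  also have "ennreal (1/2 * t) = ennreal (1/2) * ennreal t"
    by (rule ennreal_mult') simp
  finally have "ennreal t \<le> ennreal (r + 1/2 * t)"
    using assms(2) real t by (simp only:)
  then have "t \<le> r + 1/2 * t"
    using real t by (subst (asm) ennreal_le_iff) auto
  then have "ennreal t \<le> ennreal (2 * r)"
    by (intro ennreal_leI) auto
  then show ?thesis
    using real t by (simp add: ennreal_mult')
qed (simp add: ennreal_mult_top)

text \<open>The product is a constant times \<open>l powr (- ((1 - s) * p))\<close>, which tends to
  zero because \<open>s < 1\<close>.\<close>

lemma kernel_const_absorbable:
  fixes M p s :: real
  assumes "0 < p" "s < 1" "0 \<le> M"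
  shows "\<exists>l\<ge>4. M * (kernel_const TYPE('a::euclidean_space) (DIM('a) + s * p) l * (4 / l) powr p) \<le> 1/2"
proof -
  define N where "N = M * (unit_ball_vol DIM('a) * 8 powr real DIM('a) * 2 powr (DIM('a) + s * p) * 4 powr p)"
  have "((\<lambda>l::real. N * l powr (- ((1 - s) * p))) \<longlongrightarrow> N * 0) at_top"
    using assms by (intro tendsto_mult_left tendsto_neg_powr filterlim_ident) auto
  then have "eventually (\<lambda>l. N * l powr (- ((1 - s) * p)) < 1/2) at_top"
    by (intro order_tendstoD(2)) auto
  then obtain l where l: "4 \<le> l" "N * l powr (- ((1 - s) * p)) < 1/2"
    using eventually_happens'[OF _ eventually_conj[OF _ eventually_ge_at_top[of 4]]]
    by (metis (no_types, lifting) trivial_limit_at_top_linorder)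
  have "(4 / l) powr p = 4 powr p * l powr (- p)"
    using l by (simp add: powr_divide powr_minus_divide)
  moreover have "l powr (s * p) * l powr (- p) = l powr (- ((1 - s) * p))"
    by (simp add: algebra_simps flip: powr_add)
  ultimately have "M * (kernel_const TYPE('a) (DIM('a) + s * p) l * (4 / l) powr p)
     = N * l powr (- ((1 - s) * p))"
    by (simp add: kernel_const_def N_def mult_ac)
  with l show ?thesis
    by (intro exI[of _ l]) auto
qed

text \<open>Near pairs are charged to a piece containing \<open>x\<close> and estimated by
  \<open>cone_energy\<close>, far pairs by the L^p mass. The resulting constant does not depend on
  the truncation \<epsilon>, which can therefore be removed at the end.\<close>

lemma cone_cover_energy_le:
  fixes D :: "'a::euclidean_space set" and A :: "nat \<Rightarrow> 'a set"
  assumes \<kappa>: "0 < \<kappa>" "\<kappa> \<le> 1/2" and "0 < \<rho>"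
    and cone: "\<And>i. i < n \<Longrightarrow> cone_condition D (A i) (e i) \<kappa> \<rho>" and cover: "D \<subseteq> (\<Union>i<n. A i)"
    and p: "0 < p" and s: "0 < s" "s < 1"
    and D [measurable]: "D \<in> sets borel" and fin: "emeasure lborel D < top"
  defines "q \<equiv> real DIM('a) + s * p"
  shows "\<exists>K>0. \<forall>u\<in>borel_measurable borel.
    pair_energy q (W_dens p UNIV D D u) \<le> ennreal K * (Lp_mass p D u + pair_energy q (X_dens p D u))"
proof -
  define c where "c = cone_const TYPE('a) p \<kappa>"
  have c: "0 < c"
    using \<kappa> by (simp add: c_def cone_const_def)
  have q: "0 \<le> q"
    using p s by (simp add: q_def)
  \<comment> \<open>This factor collects the \<open>n\<close> pieces, the constant of the three-term
    inequality and the division by \<open>c\<close>; \<open>l\<close> is chosen so that the W-terms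
    of all pieces together have coefficient at most \<open>1/2\<close>.\<close>
  have "0 \<le> real n * 3 powr p / c"
    using c by simp
  from kernel_const_absorbable[OF p s(2) this, where ?'a = 'a] obtain l where l: "4 \<le> l"
    "real n * 3 powr p / c * (kernel_const TYPE('a) q l * (4 / l) powr p) \<le> 1/2"
    by (auto simp: q_def)
  define B where "B = 3 powr p * kernel_const TYPE('a) q l / c"
  have B: "0 \<le> B"
    using c by (simp add: B_def kernel_const_def)
  have absorb: "real n * B * (4 / l) powr p \<le> 1/2"
    using l(2) by (simp add: B_def mult_ac)
  define \<delta> where "\<delta> = \<rho> / l"
  have \<delta>: "0 < \<delta>"
    using \<open>0 < \<rho>\<close> l by (simp add: \<delta>_def)
  obtain m where m: "emeasure lborel D = ennreal m" "0 \<le> m"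
    using fin by (cases "emeasure lborel D") auto
  define F where "F \<epsilon> = 2 * 3 powr p * \<epsilon> powr (- q) * m" for \<epsilon> :: real
  have F: "0 \<le> F \<epsilon>" for \<epsilon>
    using m by (simp add: F_def)
  have far: "pair_energy q (W_dens p {\<epsilon>..} D D u) \<le> ennreal (F \<epsilon>) * Lp_mass p D u"
    if "0 < \<epsilon>" "u \<in> borel_measurable borel" for \<epsilon> u
    using far_energy_le[OF that(1) p q that(2) D] m by (simp add: F_def ennreal_mult'')
  \<comment> \<open>The \<open>1\<close> ensures positivity; the other terms are twice the
    coefficients of \<open>?L\<close> and \<open>?X\<close>, as absorption doubles them.\<close>
  define K where "K = 1 + 2 * F \<delta> + 4 * (real n * B)"
  have K: "0 < K"
    using F[of \<delta>] B by (auto simp: K_def intro!: add_pos_nonneg)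
  have "pair_energy q (W_dens p {\<epsilon><..} D D u) \<le> ennreal K * (Lp_mass p D u + pair_energy q (X_dens p D u))"
    if \<epsilon>: "0 < \<epsilon>" and [measurable]: "u \<in> borel_measurable borel" for u \<epsilon>
  proof (cases "Lp_mass p D u = top")
    case True
    then show ?thesis
      using K by (simp add: ennreal_mult_top)
  next
    case False
    let ?W = "pair_energy q (W_dens p {\<epsilon><..} D D u)" and ?X = "pair_energy q (X_dens p D u)"
      and ?L = "Lp_mass p D u"
    \<comment> \<open>This bound depends on \<epsilon> and is used only for the finiteness that
      absorption requires.\<close>
    have "?W \<le> pair_energy q (W_dens p {\<epsilon>..} D D u)"
      by (intro pair_energy_mono) (auto simp: W_dens_def indicator_def)
    also have "\<dots> \<le> ennreal (F \<epsilon>) * ?L"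
      using \<epsilon> by (intro far) auto
    also have "\<dots> < top"
      using False by (simp add: ennreal_mult_less_top less_top)
    finally have Wfin: "?W < top" .
    have near: "pair_energy q (W_dens p {\<epsilon><..<\<delta>} (A i) D u)
        \<le> ennreal B * (2 * ?X + ennreal ((4 / l) powr p) * ?W)" if "i < n" for i
    proof -
      let ?P = "pair_energy q (W_dens p {\<epsilon><..<\<delta>} (A i) D u)"
      have "ennreal (1 / c) * (ennreal c * ?P) \<le> ennreal (1 / c) * (ennreal (3 powr p * kernel_const TYPE('a) q l) *
          (2 * ?X + ennreal ((4 / l) powr p) * ?W))"
        unfolding c_def \<delta>_def using l p q \<epsilon> \<kappa>
        by (intro mult_left_mono cone_energy[OF cone[OF that]]) auto
      moreover have "ennreal (1 / c) * (ennreal c * ?P) = ?P"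
        using c by (simp add: mult.assoc[symmetric] ennreal_mult'[symmetric])
      moreover have "ennreal (1 / c) * (ennreal (3 powr p * kernel_const TYPE('a) q l) * Z) = ennreal B * Z" for Z
        using c by (simp add: mult.assoc[symmetric] ennreal_mult'[symmetric] B_def)
      ultimately show ?thesis
        by simp
    qed
    have [measurable]: "A i \<in> sets borel" if "i < n" for i
      using cone[OF that] by (simp add: cone_condition_def)
    have "?W \<le> pair_energy q (\<lambda>x y. (\<Sum>i<n. W_dens p {\<epsilon><..<\<delta>} (A i) D u x y) + W_dens p {\<delta>..} D D u x y)"
    proof (intro pair_energy_mono)
      fix x y
      show "W_dens p {\<epsilon><..} D D u x y \<le> (\<Sum>i<n. W_dens p {\<epsilon><..<\<delta>} (A i) D u x y) + W_dens p {\<delta>..} D D u x y"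
      proof (cases "x \<in> D \<and> norm (x - y) < \<delta>")
        case True
        then obtain i where i: "i < n" "x \<in> A i"
          using cover by auto
        have "W_dens p {\<epsilon><..} D D u x y = W_dens p {\<epsilon><..<\<delta>} (A i) D u x y"
          using True i by (auto simp: W_dens_def indicator_def)
        also have "\<dots> \<le> (\<Sum>i<n. W_dens p {\<epsilon><..<\<delta>} (A i) D u x y)"
          using i by (intro member_le_sum) auto
        finally show ?thesis
          by (rule add_increasing2[rotated]) simp
      next
        case False
        then have "W_dens p {\<epsilon><..} D D u x y \<le> W_dens p {\<delta>..} D D u x y"
          by (auto simp: W_dens_def indicator_def)
        then show ?thesis
          by (rule add_increasing[rotated]) simp
      qed
    qed
    also have "\<dots> = (\<Sum>i<n. pair_energy q (W_dens p {\<epsilon><..<\<delta>} (A i) D u)) + pair_energy q (W_dens p {\<delta>..} D D u)"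
    proof (subst pair_energy_add)
      have [measurable]: "case_prod (W_dens p {\<epsilon><..<\<delta>} (A i) D u) \<in> borel_measurable (lborel \<Otimes>\<^sub>M lborel)"
        if "i \<in> {..<n}" for i
        using that by (intro measurable_W_dens) auto
      show "case_prod (\<lambda>x y. \<Sum>i<n. W_dens p {\<epsilon><..<\<delta>} (A i) D u x y) \<in> borel_measurable (lborel \<Otimes>\<^sub>M lborel)"
        unfolding case_prod_beta by measurable
    qed (auto simp: pair_energy_sum)
    also have "\<dots> \<le> (\<Sum>i<n. ennreal B * (2 * ?X + ennreal ((4 / l) powr p) * ?W)) + ennreal (F \<delta>) * ?L"
      using \<delta> by (intro add_mono sum_mono near far) auto
    also have "(\<Sum>i<n. ennreal B * (2 * ?X + ennreal ((4 / l) powr p) * ?W))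
        = ennreal (real n * B) * (2 * ?X) + ennreal (real n * B * (4 / l) powr p) * ?W"
      using B by (simp add: ennreal_mult'' ennreal_mult' distrib_left mult.assoc ennreal_of_nat_eq_real_of_nat)
    also have "ennreal (real n * B * (4 / l) powr p) * ?W \<le> ennreal (1/2) * ?W"
      using absorb by (intro mult_right_mono ennreal_leI) auto
    finally have "?W \<le> (ennreal (real n * B) * (2 * ?X) + ennreal (F \<delta>) * ?L) + ennreal (1/2) * ?W"
      by (simp add: add_ac)
    then have "?W \<le> 2 * (ennreal (real n * B) * (2 * ?X) + ennreal (F \<delta>) * ?L)"
      using Wfin by (rule ennreal_absorb_half[rotated])
    also have "\<dots> = ennreal (4 * (real n * B)) * ?X + ennreal (2 * F \<delta>) * ?L"
    proof -
      have "2 * (b * (2 * x) + f * y) = (4 * b) * x + (2 * f) * y" for b f x y :: ennreal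
      proof -
        have "2 * (b * (2 * x) + f * y) = ((2 * 2) * b) * x + (2 * f) * y"
          by (simp only: distrib_left mult_ac)
        then show ?thesis
          by (simp only: numeral_times_numeral semiring_norm)
      qed
      moreover have "ennreal (4 * (real n * B)) = 4 * ennreal (real n * B)" "ennreal (2 * F \<delta>) = 2 * ennreal (F \<delta>)"
        by (subst ennreal_mult'; simp)+
      ultimately show ?thesis
        by (simp only:)
    qed
    also have "\<dots> \<le> ennreal K * ?X + ennreal K * ?L"
      using F[of \<delta>] B by (intro add_mono mult_right_mono ennreal_leI) (auto simp: K_def)
    finally show ?thesis
      by (simp add: distrib_left add.commute)
  qed
  then have "pair_energy q (W_dens p UNIV D D u) \<le> ennreal K * (Lp_mass p D u + pair_energy q (X_dens p D u))"
    if "u \<in> borel_measurable borel" for u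
    using that by (intro W_dens_UNIV_le) auto
  then show ?thesis
    using K by blast
qed

section \<open>Equivalence of the norms\<close>

text \<open>Each coordinate of the extension by zero agrees almost everywhere with a Borel function.
  Borel fields are what the Tonelli arguments over \<open>lborel\<close> were stated for.\<close>

lemma lebesgue_on_borel_representative:
  fixes u :: "'a::euclidean_space \<Rightarrow> 'a"
  assumes "D \<in> sets lebesgue" "u \<in> borel_measurable (lebesgue_on D)"
  shows "\<exists>v\<in>borel_measurable borel. AE x in lborel. x \<in> D \<longrightarrow> u x = v x"
proof -
  define g where "g x = (if x \<in> D then u x else 0)" for x
  have g: "g \<in> borel_measurable lebesgue"
    unfolding g_def by (rule borel_measurable_if_I[OF assms(2,1)])
  have "\<exists>h\<in>borel_measurable borel. AE x in lborel. g x \<bullet> b = h x" for b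
  proof -
    have "(\<lambda>x. g x \<bullet> b) \<in> borel_measurable (completion lborel)"
      using g by (intro borel_measurable_inner) auto
    from completion_ex_borel_measurable_real[OF this] show ?thesis
      by simp
  qed
  then obtain h where h: "\<And>b. h b \<in> borel_measurable borel" "\<And>b. AE x in lborel. g x \<bullet> b = h b x"
    by metis
  define v where "v x = (\<Sum>b\<in>Basis. h b x *\<^sub>R b)" for x
  have "v \<in> borel_measurable borel"
    unfolding v_def using h(1) by (intro borel_measurable_sum borel_measurable_scaleR) auto
  moreover have "AE x in lborel. \<forall>b\<in>Basis. g x \<bullet> b = h b x"
    using h(2) by (intro AE_finite_allI) auto
  then have "AE x in lborel. x \<in> D \<longrightarrow> u x = v x"
  proof eventually_elim
    case (elim x)
    then have "g x = v x"
      unfolding v_def by (metis (no_types, lifting) euclidean_representation sum.cong)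
    then show ?case
      by (auto simp: g_def)
  qed
  ultimately show ?thesis
    by blast
qed

lemma nn_integral_lebesgue_on:
  assumes "D \<in> sets lebesgue"
  shows "(\<integral>\<^sup>+x. f x \<partial>lebesgue_on D) = (\<integral>\<^sup>+x. indicator D x * f x \<partial>lborel)"
  using assms by (simp add: nn_integral_restrict_space nn_integral_completion mult.commute)

text \<open>The exceptional null set is discarded twice: in the inner integral for each good
  \<open>x\<close>, then in the outer one.\<close>

lemma double_integral_lebesgue_on_cong:
  assumes D: "D \<in> sets lebesgue" and ae: "AE x in lborel. x \<in> D \<longrightarrow> u x = v x"
  shows "(\<integral>\<^sup>+x. \<integral>\<^sup>+y. f x y (u x) (u y) \<partial>lebesgue_on D \<partial>lebesgue_on D)
    = (\<integral>\<^sup>+x. \<integral>\<^sup>+y. indicator D x * indicator D y * f x y (v x) (v y) \<partial>lborel \<partial>lborel)"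
proof -
  have "indicator D x * (\<integral>\<^sup>+y. indicator D y * f x y (u x) (u y) \<partial>lborel)
      = (\<integral>\<^sup>+y. indicator D x * indicator D y * f x y (v x) (v y) \<partial>lborel)"
    if "x \<in> D \<longrightarrow> u x = v x" for x
  proof (cases "x \<in> D")
    case True
    have "(\<integral>\<^sup>+y. indicator D y * f x y (u x) (u y) \<partial>lborel)
        = (\<integral>\<^sup>+y. indicator D y * f x y (v x) (v y) \<partial>lborel)"
      using ae True that by (intro nn_integral_cong_AE) (auto elim!: eventually_mono simp: indicator_def)
    then show ?thesis
      using True by simp
  qed simp
  then show ?thesis
    unfolding nn_integral_lebesgue_on[OF D]
    using ae by (intro nn_integral_cong_AE) (auto elim!: eventually_mono)
qed

lemma powers_eq_pair_energy:
  fixes D :: "'a::euclidean_space set" and s p :: real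
  assumes D: "D \<in> sets lebesgue" and ae: "AE x in lborel. x \<in> D \<longrightarrow> u x = v x"
  shows "Lp_power p D u = Lp_mass p D v"
    and "W_power s p D u = pair_energy (real DIM('a) + s * p) (W_dens p UNIV D D v)"
    and "X_power s p D u = pair_energy (real DIM('a) + s * p) (X_dens p D v)"
proof -
  show "Lp_power p D u = Lp_mass p D v"
    unfolding Lp_power_def Lp_mass_def nn_integral_lebesgue_on[OF D]
    using ae by (intro nn_integral_cong_AE) (auto elim!: eventually_mono simp: indicator_def)
  \<comment> \<open>At \<open>t = 0\<close> both sides are \<open>0\<close>, so the diagonal
    conventions agree.\<close>
  have div: "ennreal (a powr p / t powr q) = ennreal (a powr p) * ennreal (t powr (- q))" for a t q
    by (simp add: powr_minus divide_inverse ennreal_mult'')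
  show "W_power s p D u = pair_energy (real DIM('a) + s * p) (W_dens p UNIV D D v)"
    unfolding W_power_def pair_energy_def W_dens_def
    by (rule trans[OF double_integral_lebesgue_on_cong[OF D ae, of
      "\<lambda>x y a b. ennreal (norm (a - b) powr p / norm (x - y) powr (real DIM('a) + s * p))"]])
      (simp only: div indicator_UNIV mult_1_right mult.assoc)
  show "X_power s p D u = pair_energy (real DIM('a) + s * p) (X_dens p D v)"
    unfolding X_power_def pair_energy_def X_dens_def proj_diff_def
    by (rule trans[OF double_integral_lebesgue_on_cong[OF D ae, of
      "\<lambda>x y a b. ennreal (\<bar>(a - b) \<bullet> ((x - y) /\<^sub>R norm (x - y))\<bar> powr p / norm (x - y) powr (real DIM('a) + s * p))"]])
      (simp only: div mult.assoc)
qed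

section \<open>Comparison of the norms and of the closures\<close>

lemma ennreal_powr_mono:
  assumes "a \<le> b" "0 \<le> r"
  shows "ennreal_powr a r \<le> ennreal_powr b r"
  using assms by (auto simp: ennreal_powr_def top_unique less_top
      intro!: ennreal_leI powr_mono2 enn2real_mono)

lemma ennreal_powr_cmult:
  assumes "0 < c"
  shows "ennreal_powr (ennreal c * a) r = ennreal (c powr r) * ennreal_powr a r"
proof (cases a)
  case (real t)
  then show ?thesis
    using assms by (simp add: ennreal_powr_def powr_mult flip: ennreal_mult)
qed (use assms in \<open>simp add: ennreal_powr_def ennreal_mult_top\<close>)

lemma ennreal_powr_less_top:
  "ennreal_powr a r < top \<Longrightarrow> a < top"
  by (auto simp: ennreal_powr_def less_top split: if_splits)

lemma X_power_le_W_power: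
  assumes "0 \<le> p"
  shows "X_power s p D u \<le> W_power s p D u"
  unfolding X_power_def W_power_def
proof (intro nn_integral_mono ennreal_leI divide_right_mono powr_mono2)
  fix x y
  have "\<bar>(u x - u y) \<bullet> ((x - y) /\<^sub>R norm (x - y))\<bar> \<le> norm (u x - u y) * norm ((x - y) /\<^sub>R norm (x - y))"
    by (rule Cauchy_Schwarz_ineq2)
  also have "\<dots> \<le> norm (u x - u y) * 1"
    by (intro mult_left_mono) (cases "x = y", auto)
  finally show "\<bar>(u x - u y) \<bullet> ((x - y) /\<^sub>R norm (x - y))\<bar> \<le> norm (u x - u y)"
    by simp
qed (use assms in auto)

lemma Cc1_borel_measurable:
  assumes "open D" "\<phi> \<in> Cc1 D"
  shows "\<phi> \<in> borel_measurable (lebesgue_on D)"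
proof -
  have "continuous_on D \<phi>"
    using assms unfolding Cc1_def C1_on_def
    by (auto intro!: continuous_at_imp_continuous_on dest: has_derivative_continuous)
  then show ?thesis
    using assms(1) by (intro continuous_imp_measurable_on_sets_lebesgue) auto
qed

text \<open>One inclusion follows from Cauchy-Schwarz. For the other, \<open>WX\<close> is applied
  to \<open>u\<close> and to the differences of \<open>u\<close> and test fields, hence its form for
  all measurable fields.\<close>

lemma norm_le_imp_spaces_eq:
  fixes D :: "'a::euclidean_space set"
  assumes "open D" "0 < p" "0 < C"
    and WX: "\<And>u. u \<in> borel_measurable (lebesgue_on D) \<Longrightarrow> W_norm s p D u \<le> ennreal C * X_norm s p D u"
  shows "X0_space s p D = W0_space s p D"
proof
  have XW: "X_norm s p D u \<le> W_norm s p D u" for u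
    unfolding X_norm_def W_norm_def
    using \<open>0 < p\<close> by (simp add: ennreal_powr_mono add_left_mono X_power_le_W_power)
  have fin: "X_power s p D u < top" if "W_power s p D u < top" for u
    using X_power_le_W_power[of p s D u] that \<open>0 < p\<close> by (auto intro: le_less_trans)
  show "W0_space s p D \<subseteq> X0_space s p D"
  proof
    fix u assume u: "u \<in> W0_space s p D"
    then have "u \<in> X_space s p D"
      using fin by (auto simp: W0_space_def W_space_def X_space_def)
    moreover have "\<exists>\<phi>\<in>Cc1 D. X_norm s p D (\<lambda>x. u x - \<phi> x) < ennreal \<epsilon>" if "0 < \<epsilon>" for \<epsilon>
      using u that XW unfolding W0_space_def by (blast intro: le_less_trans)
    ultimately show "u \<in> X0_space s p D"
      by (simp add: X0_space_def)
  qed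
  show "X0_space s p D \<subseteq> W0_space s p D"
  proof
    fix u assume u: "u \<in> X0_space s p D"
    then have meas: "u \<in> borel_measurable (lebesgue_on D)" and Lp: "u \<in> Lp_space p D"
      and fin: "Lp_power p D u < top" "X_power s p D u < top"
      by (auto simp: X0_space_def X_space_def Lp_space_def)
    have "X_norm s p D u < top"
      using fin by (auto simp: X_norm_def ennreal_powr_def)
    then have "W_norm s p D u < top"
      using WX[OF meas] by (auto intro: le_less_trans simp: ennreal_mult_less_top)
    then have "W_power s p D u < top"
      unfolding W_norm_def by (auto dest: ennreal_powr_less_top)
    moreover have "\<exists>\<phi>\<in>Cc1 D. W_norm s p D (\<lambda>x. u x - \<phi> x) < ennreal \<epsilon>" if "0 < \<epsilon>" for \<epsilon>
    proof -
      \<comment> \<open>The factor \<open>2\<close> leaves room for the strict inequality after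
        multiplying by \<open>C\<close>.\<close>
      have "0 < \<epsilon> / (2 * C)"
        using that \<open>0 < C\<close> by simp
      then obtain \<phi> where \<phi>: "\<phi> \<in> Cc1 D" "X_norm s p D (\<lambda>x. u x - \<phi> x) < ennreal (\<epsilon> / (2 * C))"
        using u unfolding X0_space_def by blast
      have "(\<lambda>x. u x - \<phi> x) \<in> borel_measurable (lebesgue_on D)"
        using meas Cc1_borel_measurable[OF \<open>open D\<close> \<phi>(1)] by (rule borel_measurable_diff)
      then have "W_norm s p D (\<lambda>x. u x - \<phi> x) \<le> ennreal C * X_norm s p D (\<lambda>x. u x - \<phi> x)"
        by (rule WX)
      also have "\<dots> \<le> ennreal C * ennreal (\<epsilon> / (2 * C))"
        using \<phi>(2) by (intro mult_left_mono) auto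
      also have "\<dots> = ennreal (\<epsilon> / 2)"
        using \<open>0 < C\<close> that by (simp flip: ennreal_mult)
      also have "\<dots> < ennreal \<epsilon>"
        using that by (simp add: ennreal_lessI)
      finally show ?thesis
        using \<phi>(1) by blast
    qed
    ultimately show "u \<in> W0_space s p D"
      using Lp by (simp add: W0_space_def W_space_def)
  qed
qed

theorem theorem1p1:
  fixes s p :: real
  assumes "1 < p" and "0 < s" and "s < 1" and "s * p \<noteq> 1"
  shows "\<exists>L0>0. \<forall>D :: ((real ^ 'm) \<times> real) set.
           open D \<and> bounded D \<and> (C1_set D \<or> (\<exists>L. 0 < L \<and> L \<le> L0 \<and> Lipschitz_set L D)) \<longrightarrow>
             (\<exists>C::real. C \<ge> 1 \<and>
               (\<forall>u\<in>X0_space s p D. ennreal C * X_norm s p D u \<ge> W_norm s p D u)) \<and>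
             X0_space s p D = W0_space s p D"
\<comment> \<open>The aperture of the cones adapts to the Lipschitz constant, so \<open>1\<close>
  can be taken for \<open>L0\<close>.\<close>
proof (rule exI[of _ 1], intro conjI allI impI)
  fix D :: "((real ^ 'm) \<times> real) set"
  assume "open D \<and> bounded D \<and> (C1_set D \<or> (\<exists>L. 0 < L \<and> L \<le> 1 \<and> Lipschitz_set L D))"
  then have D: "open D" "bounded D" and "C1_set D \<or> (\<exists>L. 0 < L \<and> L \<le> 1 \<and> Lipschitz_set L D)"
    by auto
  from this(3) have "\<exists>(n::nat) A e \<kappa> \<rho>. 0 < \<kappa> \<and> \<kappa> \<le> 1/2 \<and> 0 < \<rho> \<and>
      (\<forall>i<n. cone_condition D (A i) (e i) \<kappa> \<rho>) \<and> D \<subseteq> (\<Union>i<n. A i)"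
  proof (elim disjE exE conjE)
    assume "C1_set D"
    then have "locally_epigraph (\<lambda>f. C1_on UNIV f) D"
      by (simp add: C1_set_def)
    then show ?thesis
      by (rule locally_epigraph_cone_cover[OF _ D]) (rule C1_on_UNIV_lipschitz, assumption)+
  next
    fix L assume "Lipschitz_set L D"
    then have "locally_epigraph (\<lambda>f. L-lipschitz_on UNIV f) D"
      by (simp add: Lipschitz_set_def)
    then show ?thesis
    proof (rule locally_epigraph_cone_cover[OF _ D])
      fix f :: "real ^ 'm \<Rightarrow> real" and M assume f: "L-lipschitz_on UNIV f"
      then show "continuous_on UNIV f"
        by (rule lipschitz_on_continuous_on)
      show "\<exists>L. L-lipschitz_on (cball 0 M) f"
        using lipschitz_on_subset[OF f] by blast
    qed
  qed
  then obtain n :: nat and A e \<kappa> \<rho> where cones: "0 < \<kappa> \<and> \<kappa> \<le> 1/2 \<and> 0 < \<rho> \<and>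
      (\<forall>i<n. cone_condition D (A i) (e i) \<kappa> \<rho>) \<and> D \<subseteq> (\<Union>i<n. A i)"
    by (elim exE)
  have borel: "D \<in> sets borel" and lebesgue: "D \<in> sets lebesgue"
    using D(1) by auto
  have fin: "emeasure lborel D < top"
    using emeasure_bounded_finite[OF D(2)] by (simp add: less_top)
  let ?q = "real DIM((real ^ 'm) \<times> real) + s * p"
  have "0 < p"
    using assms(1) by simp
  have "\<exists>K>0. \<forall>v\<in>borel_measurable borel.
      pair_energy ?q (W_dens p UNIV D D v) \<le> ennreal K * (Lp_mass p D v + pair_energy ?q (X_dens p D v))"
    by (rule cone_cover_energy_le[where \<kappa> = \<kappa> and \<rho> = \<rho> and n = n and A = A and e = e])
      (use cones \<open>0 < p\<close> assms(2,3) borel fin in auto)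
  then obtain K where K: "0 < K" "\<And>v. v \<in> borel_measurable borel \<Longrightarrow>
      pair_energy ?q (W_dens p UNIV D D v) \<le> ennreal K * (Lp_mass p D v + pair_energy ?q (X_dens p D v))"
    by blast
  \<comment> \<open>The \<open>1\<close> accounts for the L^p part of the W-norm; the exponent
    undoes the \<open>p\<close>-th powers.\<close>
  define C where "C = (1 + K) powr (1 / p)"
  have C: "1 \<le> C"
    using K(1) assms(1) by (simp add: C_def ge_one_powr_ge_zero)
  have WX: "W_norm s p D u \<le> ennreal C * X_norm s p D u" if u: "u \<in> borel_measurable (lebesgue_on D)" for u
  proof -
    obtain v where v: "v \<in> borel_measurable borel" "AE x in lborel. x \<in> D \<longrightarrow> u x = v x"
      using lebesgue_on_borel_representative[OF lebesgue u] by blast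
    have "W_power s p D u \<le> ennreal K * (Lp_power p D u + X_power s p D u)"
      unfolding powers_eq_pair_energy[OF lebesgue v(2)] using v(1) by (rule K(2))
    then have "Lp_power p D u + W_power s p D u
        \<le> (Lp_power p D u + X_power s p D u) + ennreal K * (Lp_power p D u + X_power s p D u)"
      by (intro add_mono) auto
    also have "\<dots> = ennreal (1 + K) * (Lp_power p D u + X_power s p D u)"
      using K(1) by (simp add: ennreal_plus distrib_right)
    finally have "W_norm s p D u \<le> ennreal_powr (ennreal (1 + K) * (Lp_power p D u + X_power s p D u)) (1 / p)"
      unfolding W_norm_def using assms(1) by (intro ennreal_powr_mono) auto
    also have "\<dots> = ennreal C * X_norm s p D u"
      unfolding C_def X_norm_def using K(1) by (intro ennreal_powr_cmult) simp
    finally show ?thesis .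
  qed
  have "u \<in> borel_measurable (lebesgue_on D)" if "u \<in> X0_space s p D" for u
    using that by (auto simp: X0_space_def X_space_def Lp_space_def)
  then show "\<exists>C\<ge>1. \<forall>u\<in>X0_space s p D. W_norm s p D u \<le> ennreal C * X_norm s p D u"
    using WX C by blast
  show "X0_space s p D = W0_space s p D"
    using D(1) assms(1) C WX by (intro norm_le_imp_spaces_eq[of D p C]) auto
qed simp

end
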